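(* Let $p$ be an odd prime, $c\in\mathbb Z_p$ with $c(c^2+1)\not\equiv0\pmod p$. Then $$2c\sum_{k=(p+1)/2}^{[3p/4]}\binom{4k}{2k}\frac1{(16(c^2+1))^k}\equiv-4c\sum_{k=1}^{[\frac{p+1}4]}\binom{4k-2}{2k-1}\frac1{(16(c^2+1))^k}\equiv\begin{cases}0\pmod p&\text{if }\big(\frac{c^2+1}p\big)=1,\\1\pmod p&\text{if }c\in Q_1(p),\\-1\pmod p&\text{if }c\in Q_3(p).\end{cases}$$
   Context: $[x]$ is the greatest integer $\le x$; $\mathbb Z_p$ is the set of rational numbers whose denominator is not divisible by $p$; $(\frac{\cdot}{p})$ is the Legendre symbol; $i=\sqrt{-1}$. Quartic Jacobi symbol: for a Gaussian prime $\pi\nmid 2$ and a Gaussian integer $\alpha$, $(\frac{\alpha}{\pi})_4$ is the unique element of $\{0,1,i,-1,-i\}$ congruent to $\alpha^{(N\pi-1)/4}$ modulo $\pi$. For an odd rational prime $p$, $(\frac{\alpha}{p})_4=\prod_j(\frac{\alpha}{\pi_j})_4$ where $p=\prod_j\pi_j$ is the factorization into Gaussian primes. For $m,n\in\mathbb Z_p$, $(\frac{m+ni}{p})_4$ is defined as $(\frac{\alpha}{p})_4$ for any Gaussian integer $\alpha\equiv m+ni\pmod p$. For $r=0,1,2,3$, $Q_r(p)=\{c\in\mathbb Z_p:(\frac{c+i}{p})_4=i^r\}$. (When $(\frac{c^2+1}p)=-1$, $c\in Q_1(p)\cup Q_3(p)$.) *)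

theory Defs
  imports Complex_Main "HOL-Number_Theory.Number_Theory"
begin

definition Zp :: "nat \<Rightarrow> rat set" where
  "Zp p = {x. \<not> int p dvd snd (quotient_of x)}"

definition rat_cong :: "nat \<Rightarrow> rat \<Rightarrow> rat \<Rightarrow> bool" where
  "rat_cong p x y \<longleftrightarrow> (\<exists>z\<in>Zp p. x - y = of_nat p * z)"

definition rep :: "nat \<Rightarrow> rat \<Rightarrow> int" where
  "rep p x = (SOME a::int. rat_cong p x (of_int a))"

definition Zi :: "complex set" where
  "Zi = {z. Re z \<in> \<int> \<and> Im z \<in> \<int>}"

definition gdvd :: "complex \<Rightarrow> complex \<Rightarrow> bool" where
  "gdvd a b \<longleftrightarrow> (\<exists>c\<in>Zi. b = a * c)"

definition gcong :: "complex \<Rightarrow> complex \<Rightarrow> complex \<Rightarrow> bool" where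
  "gcong m a b \<longleftrightarrow> gdvd m (a - b)"

definition gunit :: "complex \<Rightarrow> bool" where
  "gunit u \<longleftrightarrow> u \<in> Zi \<and> (\<exists>v\<in>Zi. u * v = 1)"

definition gprime :: "complex \<Rightarrow> bool" where
  "gprime q \<longleftrightarrow> q \<in> Zi \<and> q \<noteq> 0 \<and> \<not> gunit q \<and>
     (\<forall>a\<in>Zi. \<forall>b\<in>Zi. q = a * b \<longrightarrow> gunit a \<or> gunit b)"

definition gnorm :: "complex \<Rightarrow> int" where
  "gnorm z = \<lfloor>Re z ^ 2 + Im z ^ 2\<rfloor>"

text \<open>Quartic residue symbol modulo a Gaussian prime q (not dividing 2).\<close>
definition quartic_sym :: "complex \<Rightarrow> complex \<Rightarrow> complex" where
  "quartic_sym \<alpha> q =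
     (THE r. r \<in> {0, 1, \<i>, -1, -\<i>} \<and> gcong q r (\<alpha> ^ nat ((gnorm q - 1) div 4)))"

definition quartic_symp :: "complex \<Rightarrow> nat \<Rightarrow> complex" where
  "quartic_symp \<alpha> p =
     (let fs = (SOME fs. (\<forall>q\<in>set fs. gprime q) \<and> prod_list fs = of_nat p)
      in prod_list (map (quartic_sym \<alpha>) fs))"

definition quartic_symp_rat :: "rat \<Rightarrow> rat \<Rightarrow> nat \<Rightarrow> complex" where
  "quartic_symp_rat m n p = quartic_symp (of_int (rep p m) + of_int (rep p n) * \<i>) p"

definition Q :: "nat \<Rightarrow> nat \<Rightarrow> rat set" where
  "Q r p = {c \<in> Zp p. quartic_symp_rat c 1 p = \<i> ^ r}"

end

(* Modulo p the first sum is 2 ((c^2+1)/p) times the second one without its factor -4c, because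
   binomial(2(p+r), p+r) = 2 binomial(2r, r) (mod p). Let n = (p-1)/2 and let M be an inverse of
   N = c^2+1. Since binomial(2r, r) = (-4)^r binomial(n, r) (mod p), the second sum becomes
   c E with E = sum_j binomial(n, 2j-1) M^j, and 2E = v (A - A') for v = sqrt M, A = (1+v)^n,
   A' = (1-v)^n. Here A A' = (M/p) and, by Frobenius, A^2 (1+v) = 1 + (M/p) v modulo p.
   If (M/p) = 1 this forces A = A'. If (M/p) = -1 it gives E A (1+v) = v, and A is evaluated by
   raising the identity ((c+i) v + i)^2 = 2 i (c+i) v (1+v) (mod p) to a suitable power: this
   expresses cE as a power of i times ((c+i)/(c-i))^((p-1)/4) or ((c+i)/(c-i))^((p+1)/4), that
   is, through the quartic symbol. All this happens modulo p in the ring Z[i, v] inside the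
   complex numbers; congruences between Gaussian integers descend from it to Z[i]. *)
theory Submission
  imports Defs
begin

section \<open>Congruences in subrings and binomial coefficients\<close>

text \<open>The relations for \<open>A^2\<close> and \<open>A * A'\<close> survive flipping the
  signs of both \<open>A\<close> and \<open>A'\<close>, so for (M/p) = -1 they leave the sign of the
  sum open; the quartic symbol has to decide it. The square identity achieves this because its n-th
  or (n+1)-st power contains \<open>A\<close> itself, while its left side becomes the power p-1 or
  p+1 of an expression linear in \<open>v\<close>, which Frobenius evaluates. A second obstacle is
  that Z[i, v] modulo p may have zero divisors, and \<open>v\<close> may even be an integer. Hence
  only explicit units are cancelled, such as 2, c, c+i, v and 1+v; invertibility of 1+v rests on c
  being nonzero modulo p. For p = 1 (mod 4) the symbol is a product over two conjugate primes, and
  neither factor is known alone. Conjugating one of them moves both to the same prime q, which is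
  enough: the final comparison is between rational integers, and q has norm p.\<close>

text \<open>The subring is kept explicit since congruences are used in \<open>Zi\<close>, in \<open>Zp p\<close> and in
  \<open>Zi\<close> with a square root adjoined. In a field such as \<open>complex\<close> it is what makes the notion nontrivial.\<close>
definition scong :: "'a::comm_ring_1 set \<Rightarrow> 'a \<Rightarrow> 'a \<Rightarrow> 'a \<Rightarrow> bool" where
  "scong S m x y \<longleftrightarrow> (\<exists>z\<in>S. x - y = m * z)"

locale subring =
  fixes S :: "'a::comm_ring_1 set"
  assumes one_closed [simp]: "1 \<in> S"
    and diff_closed [simp]: "x \<in> S \<Longrightarrow> y \<in> S \<Longrightarrow> x - y \<in> S"
    and mult_closed [simp]: "x \<in> S \<Longrightarrow> y \<in> S \<Longrightarrow> x * y \<in> S"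
begin

lemma zero_closed [simp]: "0 \<in> S"
  using diff_closed[of 1 1] by simp

lemma uminus_closed [simp]: "x \<in> S \<Longrightarrow> - x \<in> S"
  using diff_closed[of 0 x] by simp

lemma add_closed [simp]: "x \<in> S \<Longrightarrow> y \<in> S \<Longrightarrow> x + y \<in> S"
  using diff_closed[of x "- y"] by simp

lemma of_nat_closed [simp]: "of_nat n \<in> S"
  by (induction n) auto

lemma of_int_closed [simp]: "of_int n \<in> S"
  by (cases n) auto

lemma numeral_closed [simp]: "numeral n \<in> S"
  using of_nat_closed[of "numeral n"] by simp

lemma power_closed [simp]: "x \<in> S \<Longrightarrow> x ^ n \<in> S"
  by (induction n) auto

lemma sum_closed: "(\<And>i. i \<in> A \<Longrightarrow> f i \<in> S) \<Longrightarrow> sum f A \<in> S"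
  by (induction A rule: infinite_finite_induct) auto

lemma scong_refl [simp]: "scong S m x x"
  unfolding scong_def by (rule bexI[of _ 0]) auto

lemma scong_sym: "scong S m x y \<Longrightarrow> scong S m y x"
  unfolding scong_def by (metis minus_diff_eq mult_minus_right uminus_closed)

lemma scong_trans [trans]: "scong S m x y \<Longrightarrow> scong S m y z \<Longrightarrow> scong S m x z"
proof -
  assume "scong S m x y" "scong S m y z"
  then obtain u v where "u \<in> S" "v \<in> S" "x - y = m * u" "y - z = m * v"
    unfolding scong_def by blast
  then have "u + v \<in> S" "x - z = m * (u + v)" by (auto simp: algebra_simps)
  then show ?thesis unfolding scong_def by blast
qed

lemma scong_add:
  assumes "scong S m x y" "scong S m x' y'"
  shows "scong S m (x + x') (y + y')"
proof -
  obtain u v where "u \<in> S" "v \<in> S" "x - y = m * u" "x' - y' = m * v"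
    using assms unfolding scong_def by blast
  then have "u + v \<in> S" "x + x' - (y + y') = m * (u + v)" by (auto simp: algebra_simps)
  then show ?thesis unfolding scong_def by blast
qed

lemma scong_uminus: "scong S m x y \<Longrightarrow> scong S m (- x) (- y)"
  unfolding scong_def by (metis minus_diff_minus mult_minus_right uminus_closed)

lemma scong_diff:
  "scong S m x y \<Longrightarrow> scong S m x' y' \<Longrightarrow> scong S m (x - x') (y - y')"
  using scong_add[of m x y "- x'" "- y'"] scong_uminus[of m x' y'] by simp

lemma scong_lmult:
  assumes "scong S m x y" "z \<in> S"
  shows "scong S m (z * x) (z * y)"
proof -
  obtain u where "u \<in> S" "x - y = m * u"
    using assms unfolding scong_def by blast
  then have "z * u \<in> S" "z * x - z * y = m * (z * u)"
    using assms by (auto simp: algebra_simps simp flip: right_diff_distrib)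
  then show ?thesis unfolding scong_def by blast
qed

lemma scong_mult:
  assumes "scong S m x y" "scong S m x' y'" "x' \<in> S" "y \<in> S"
  shows "scong S m (x * x') (y * y')"
  using scong_trans[OF scong_lmult[OF assms(1,3)]
      scong_lmult[OF assms(2,4), unfolded mult.commute[of y x']]]
  by (simp add: mult.commute)

lemma scong_power:
  assumes "scong S m x y" "x \<in> S" "y \<in> S"
  shows "scong S m (x ^ n) (y ^ n)"
  by (induction n) (auto intro!: scong_mult assms power_closed)

lemma scong_sum:
  "(\<And>i. i \<in> A \<Longrightarrow> scong S m (f i) (g i)) \<Longrightarrow> scong S m (sum f A) (sum g A)"
  by (induction A rule: infinite_finite_induct) (auto intro: scong_add)

lemma scong_diff_0: "scong S m (x - y) 0 \<longleftrightarrow> scong S m x y"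
  by (simp add: scong_def)

lemma scong_cancel:
  assumes "scong S m (z * x) (z * y)" "scong S m (w * z) 1" "w \<in> S" "x \<in> S" "y \<in> S"
  shows "scong S m x y"
proof -
  have e: "scong S m (u * (w * z)) u" if "u \<in> S" for u
    using scong_lmult[OF assms(2) that] by simp
  have "scong S m (w * (z * x)) (w * (z * y))"
    by (rule scong_lmult[OF assms(1,3)])
  then have "scong S m (x * (w * z)) (y * (w * z))" by (simp add: mult_ac)
  then show ?thesis using e[OF assms(4)] e[OF assms(5)] scong_sym scong_trans by blast
qed

lemma scong_of_int:
  assumes "[a = b] (mod int p)"
  shows "scong S (of_nat p) (of_int a) (of_int b)"
proof -
  obtain k where "a - b = int p * k"
    using assms by (auto simp: cong_iff_dvd_diff)
  then have "(of_int a - of_int b :: 'a) = of_nat p * of_int k"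
    by (metis of_int_diff of_int_mult of_int_of_nat_eq)
  then show ?thesis unfolding scong_def using of_int_closed by blast
qed

lemma scong_frobenius:
  assumes "prime p" "x \<in> S" "y \<in> S"
  shows "scong S (of_nat p) ((x + y) ^ p) (x ^ p + y ^ p)"
proof -
  have p: "p > 0" using assms(1) prime_gt_0_nat by blast
  have "(x + y) ^ p = (\<Sum>k\<le>p. of_nat (p choose k) * x ^ k * y ^ (p - k))"
    by (rule binomial_ring)
  also have "scong S (of_nat p) \<dots> (\<Sum>k\<le>p. if k = 0 then y ^ p else if k = p then x ^ p else 0)"
  proof (rule scong_sum)
    fix k assume k: "k \<in> {..p}"
    show "scong S (of_nat p) (of_nat (p choose k) * x ^ k * y ^ (p - k))
       (if k = 0 then y ^ p else if k = p then x ^ p else 0)"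
    proof (cases "k = 0 \<or> k = p")
      case False
      then have "p dvd p choose k" using k assms(1) by (intro dvd_choose_prime) (auto intro!: Nat.gr0I)
      then obtain j where "p choose k = p * j" by blast
      then have "of_nat (p choose k) * x ^ k * y ^ (p - k) - 0 = of_nat p * (of_nat j * x ^ k * y ^ (p - k))"
        by (simp add: mult_ac)
      moreover have "of_nat j * x ^ k * y ^ (p - k) \<in> S" using assms by simp
      ultimately show ?thesis using False unfolding scong_def by (auto intro!: bexI)
    qed (use p in auto)
  qed
  also have "(\<Sum>k\<le>p. if k = 0 then y ^ p else if k = p then x ^ p else 0)
      = (\<Sum>k\<in>{0, p}. if k = 0 then y ^ p else if k = p then x ^ p else 0)"
    by (rule sum.mono_neutral_right) auto
  also have "\<dots> = x ^ p + y ^ p" using p by simp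
  finally show ?thesis .
qed

lemma scong_fermat:
  assumes "prime p"
  shows "scong S (of_nat p) (of_nat a ^ p) (of_nat a)"
proof (induction a)
  case 0
  then show ?case using assms prime_gt_0_nat[of p] by (simp add: power_0_left)
next
  case (Suc a)
  have "scong S (of_nat p) ((1 + of_nat a) ^ p) (1 ^ p + of_nat a ^ p)"
    by (rule scong_frobenius) (use assms in auto)
  also have "scong S (of_nat p) \<dots> (1 + of_nat a)"
    using scong_add[OF scong_refl Suc] by simp
  finally show ?case by simp
qed

text \<open>Serves to pass from the modulus \<open>p = q * cnj q\<close> to the Gaussian prime
  \<open>q\<close>.\<close>

lemma scong_modulus_mult: "scong S (m * k) x y \<Longrightarrow> k \<in> S \<Longrightarrow> scong S m x y"
  unfolding scong_def by (metis mult.assoc mult_closed)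

end

section \<open>Central binomial coefficients modulo an odd prime\<close>

lemma central_binomial_Suc:
  "(r + 1) * ((2 * (r + 1)) choose (r + 1)) = 2 * (2 * r + 1) * ((2 * r) choose r)"
proof -
  have a: "(r + 1) * ((2 * r + 2) choose (r + 1)) = (2 * r + 2) * ((2 * r + 1) choose r)"
    using Suc_times_binomial[of r "2 * r + 1"] by simp
  have b: "(r + 1) * ((2 * r + 1) choose (r + 1)) = (2 * r + 1) * ((2 * r) choose r)"
    using Suc_times_binomial[of r "2 * r"] by simp
  have c: "(2 * r + 1) choose r = (2 * r + 1) choose (r + 1)"
    using binomial_symmetric[of r "2 * r + 1"] by simp
  have "(r + 1) * ((2 * (r + 1)) choose (r + 1)) = 2 * ((r + 1) * ((2 * r + 1) choose (r + 1)))"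
    using a c by (simp add: algebra_simps)
  then show ?thesis using b by simp
qed

text \<open>Modulo p, n is -1/2, and binomial(2r, r) = (-4)^r binomial(-1/2, r). The induction
  compares ratios of consecutive terms; \<open>r + 1 \<le> n < p\<close> makes the factor
  \<open>r + 1\<close> cancellable.\<close>

lemma central_binomial_cong_half:
  fixes p n r :: nat
  assumes "prime p" "p = 2 * n + 1" "r \<le> n"
  shows "[int ((2 * r) choose r) = (-4) ^ r * int (n choose r)] (mod int p)"
  using assms(3)
proof (induction r)
  case (Suc r)
  let ?B = "int ((2 * r) choose r)" and ?C = "int (n choose r)"
  have IH: "[?B = (-4) ^ r * ?C] (mod int p)" using Suc by simp
  have cB: "int (r + 1) * int ((2 * (r + 1)) choose (r + 1)) = 2 * (2 * int r + 1) * ?B"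
    using arg_cong[OF central_binomial_Suc[of r], of int]
    unfolding of_nat_mult of_nat_add of_nat_numeral of_nat_1 by argo
  have "(n choose (r + 1)) * (r + 1) = (n choose r) * (n - r)"
    by (metis Suc_eq_plus1 binomial_absorb_comp binomial_absorption mult.commute)
  then have cC: "int (n choose (r + 1)) * int (r + 1) = ?C * (int n - int r)"
    unfolding of_nat_diff[OF Suc_leD[OF Suc.prems], symmetric] of_nat_mult[symmetric] by simp
  \<comment> \<open>The two sides differ by \<open>4 * n + 2 = 2 * p\<close>.\<close>
  have e: "[2 * (2 * int r + 1) = -4 * (int n - int r)] (mod int p)"
    unfolding cong_iff_dvd_diff assms(2) by (simp add: algebra_simps) (rule dvdI[of _ _ 2], simp)
  have "int (r + 1) * int ((2 * (r + 1)) choose (r + 1)) = 2 * (2 * int r + 1) * ?B"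
    by (rule cB)
  also have "[\<dots> = (-4 * (int n - int r)) * ((-4) ^ r * ?C)] (mod int p)"
    by (rule cong_mult[OF e IH])
  also have "(-4 * (int n - int r)) * ((-4) ^ r * ?C) = (-4) ^ (r + 1) * (?C * (int n - int r))"
    by (simp add: algebra_simps)
  also have "\<dots> = int (r + 1) * ((-4) ^ (r + 1) * int (n choose (r + 1)))"
    by (subst cC[symmetric]) simp
  finally have "[int (r + 1) * int ((2 * (r + 1)) choose (r + 1))
       = int (r + 1) * ((-4) ^ (r + 1) * int (n choose (r + 1)))] (mod int p)" .
  moreover have "coprime (int (r + 1)) (int p)"
  proof -
    have "\<not> p dvd r + 1" using Suc.prems assms(2) by (auto dest: dvd_imp_le)
    then show ?thesis
      using prime_imp_coprime[OF assms(1)] by (subst coprime_commute) (simp only: coprime_int_iff)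
  qed
  ultimately show ?case
    unfolding Suc_eq_plus1 by (simp only: cong_mult_lcancel)
qed simp

lemma prime_dvd_choose_double:
  assumes "prime p" "\<not> p dvd i"
  shows "p dvd (2 * p) choose i"
proof -
  obtain j where i: "i = Suc j" using assms(2) by (cases i) auto
  have "i * ((2 * p) choose i) = 2 * p * ((2 * p - 1) choose j)"
    using i assms(1) Suc_times_binomial[of j "2 * p - 1"] prime_gt_0_nat[of p] by simp
  then have "p dvd i * ((2 * p) choose i)" by simp
  then show ?thesis using assms prime_dvd_mult_iff by blast
qed

lemma choose_double_prime_cong:
  assumes "prime p" shows "[(2 * p) choose p = 2] (mod p)"
proof -
  have p: "p > 0" using assms prime_gt_0_nat by blast
  have "(2 * p) choose p = (\<Sum>k\<le>p. (p choose k)\<^sup>2)"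
    using choose_square_sum[of p] by simp
  also have "[\<dots> = (\<Sum>k\<le>p. if k \<in> {0, p} then 1 else 0)] (mod p)"
  proof (rule cong_sum)
    fix k assume k: "k \<in> {..p}"
    show "[(p choose k)\<^sup>2 = (if k \<in> {0, p} then 1 else 0)] (mod p)"
    proof (cases "k \<in> {0, p}")
      case False
      then have "p dvd p choose k" using k assms by (intro dvd_choose_prime) (auto intro!: Nat.gr0I)
      then show ?thesis using False by (simp add: cong_0_iff power2_eq_square)
    qed auto
  qed
  also have "(\<Sum>k\<le>p. if k \<in> {0, p} then 1 else 0) = card ({..p} \<inter> {0, p})"
    by (subst sum.inter_restrict[symmetric]) simp_all
  also have "{..p} \<inter> {0, p} = {0, p}" by auto
  also have "card {0, p} = 2" using p by simp
  finally show ?thesis .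
qed

text \<open>Vandermonde for 2p + 2r: modulo p only the terms with p dividing k can survive, and
  \<open>k \<le> p + r < 2 * p\<close> leaves k = 0 and k = p. For k = 0 the cofactor binomial(2r,
  p+r) vanishes because p > r.\<close>

lemma central_binomial_cong_shift:
  assumes "prime p" "2 * r < p"
  shows "[(2 * (p + r)) choose (p + r) = 2 * ((2 * r) choose r)] (mod p)"
proof -
  have "(2 * (p + r)) choose (p + r) = (\<Sum>k\<le>p + r. ((2 * p) choose k) * ((2 * r) choose (p + r - k)))"
    using vandermonde[of "2 * p" "2 * r" "p + r"] by (simp add: algebra_simps)
  also have "[\<dots> = (\<Sum>k\<le>p + r. if k = p then 2 * ((2 * r) choose r) else 0)] (mod p)"
  proof (rule cong_sum)
    fix k assume k: "k \<in> {..p + r}"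
    show "[((2 * p) choose k) * ((2 * r) choose (p + r - k))
        = (if k = p then 2 * ((2 * r) choose r) else 0)] (mod p)"
    proof (cases "k = p")
      case True
      then show ?thesis using cong_mult[OF choose_double_prime_cong[OF assms(1)] cong_refl] by simp
    next
      case False
      show ?thesis
      proof (cases "p dvd k")
        case True
        then obtain j where j: "k = p * j" by blast
        have "p * j < p * 2" using k assms(2) j unfolding atMost_iff by linarith
        then have "j < 2" by simp
        then have "k = 0" using False j by (cases j) auto
        then show ?thesis using assms by (simp add: cong_def binomial_eq_0)
      next
        case F: False
        then show ?thesis using prime_dvd_choose_double[OF assms(1) F] False by (simp add: cong_0_iff)
      qed
    qed
  qed
  also have "(\<Sum>k\<le>p + r. if k = p then 2 * ((2 * r) choose r) else 0) = 2 * ((2 * r) choose r)"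
    by simp
  finally show ?thesis .
qed

section \<open>Gaussian integers\<close>

interpretation Zi: subring Zi
  by unfold_locales (auto simp: Zi_def)

lemma gcong_eq_scong: "gcong = scong Zi"
  by (intro ext) (auto simp: gcong_def gdvd_def scong_def)

lemma i_in_Zi [simp]: "\<i> \<in> Zi"
  by (simp add: Zi_def)

lemma cnj_in_Zi [simp]: "cnj z \<in> Zi \<longleftrightarrow> z \<in> Zi"
  by (simp add: Zi_def)

lemma gnorm_Zi:
  assumes "z \<in> Zi" shows "of_int (gnorm z) = (cmod z)\<^sup>2"
proof -
  obtain x y where "Re z = of_int x" "Im z = of_int y"
    using assms by (auto simp: Zi_def elim!: Ints_cases)
  then have "(cmod z)\<^sup>2 = of_int (x\<^sup>2 + y\<^sup>2)" "gnorm z = \<lfloor>(of_int (x\<^sup>2 + y\<^sup>2) :: real)\<rfloor>"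
    by (simp_all add: cmod_power2 gnorm_def)
  then show ?thesis by simp
qed

lemma mult_cnj_gnorm: "z \<in> Zi \<Longrightarrow> z * cnj z = of_int (gnorm z)"
  by (simp add: complex_norm_square[symmetric] gnorm_Zi[symmetric])

lemma gnorm_mult:
  assumes "a \<in> Zi" "b \<in> Zi" shows "gnorm (a * b) = gnorm a * gnorm b"
proof -
  have "(of_int (gnorm (a * b)) :: real) = of_int (gnorm a * gnorm b)"
    using assms by (simp add: gnorm_Zi norm_mult power_mult_distrib)
  then show ?thesis by (simp only: of_int_eq_iff)
qed

lemma gnorm_nonneg [simp]: "gnorm z \<ge> 0"
  by (simp add: gnorm_def)

lemma gnorm_eq_0_iff: "z \<in> Zi \<Longrightarrow> gnorm z = 0 \<longleftrightarrow> z = 0"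
  using gnorm_Zi[of z] by (metis norm_eq_zero of_int_0_eq_iff power_eq_0_iff zero_neq_numeral of_int_0 power_zero_numeral)

lemma gnorm_of_int [simp]: "gnorm (of_int n) = n\<^sup>2"
  by (simp add: gnorm_def flip: of_int_power)

lemma gnorm_of_nat [simp]: "gnorm (of_nat n) = (int n)\<^sup>2"
  using gnorm_of_int[of "int n"] by simp

lemma gnorm_cnj [simp]: "gnorm (cnj z) = gnorm z"
  by (simp add: gnorm_def)

lemma gunit_iff: "gunit z \<longleftrightarrow> z \<in> Zi \<and> gnorm z = 1"
proof
  assume "gunit z"
  then obtain v where v: "z \<in> Zi" "v \<in> Zi" "z * v = 1" by (auto simp: gunit_def)
  then have "gnorm z * gnorm v = 1" using gnorm_mult[of z v] gnorm_of_int[of 1] by simp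
  then show "z \<in> Zi \<and> gnorm z = 1" using v gnorm_nonneg[of z] pos_zmult_eq_1_iff_lemma[of "gnorm z" "gnorm v"] by linarith
next
  assume "z \<in> Zi \<and> gnorm z = 1"
  then show "gunit z" using mult_cnj_gnorm[of z] cnj_in_Zi unfolding gunit_def
    by (intro conjI bexI[of _ "cnj z"]) auto
qed

text \<open>Rounding both coordinates of \<open>a / b\<close> leaves an error of squared modulus at
  most 1/2.\<close>

lemma Zi_division:
  assumes "a \<in> Zi" "b \<in> Zi" "b \<noteq> 0"
  obtains q where "q \<in> Zi" "gnorm (a - b * q) < gnorm b"
proof -
  define q where "q = Complex (of_int (round (Re (a / b)))) (of_int (round (Im (a / b))))"
  have q: "q \<in> Zi" by (simp add: q_def Zi_def)
  have "(cmod (a / b - q))\<^sup>2 = \<bar>Re (a / b) - of_int (round (Re (a / b)))\<bar>\<^sup>2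
      + \<bar>Im (a / b) - of_int (round (Im (a / b)))\<bar>\<^sup>2"
    by (simp add: cmod_power2 q_def)
  also have "\<dots> \<le> (1/2)\<^sup>2 + (1/2)\<^sup>2"
    using of_int_round_abs_le[of "Re (a / b)"] of_int_round_abs_le[of "Im (a / b)"]
    by (intro add_mono power_mono) (auto simp: abs_minus_commute)
  finally have "(cmod (a / b - q))\<^sup>2 < 1" by (simp add: power2_eq_square)
  moreover have "a - b * q = b * (a / b - q)" using assms(3) by (simp add: field_simps)
  then have "(cmod (a - b * q))\<^sup>2 = (cmod b)\<^sup>2 * (cmod (a / b - q))\<^sup>2"
    by (simp only: norm_mult power_mult_distrib)
  ultimately have "(cmod (a - b * q))\<^sup>2 < (cmod b)\<^sup>2"
    using assms(3) by simp
  then have "(of_int (gnorm (a - b * q)) :: real) < of_int (gnorm b)"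
    using assms q by (simp add: gnorm_Zi)
  then show ?thesis using that q by simp
qed

text \<open>\<open>gprime\<close> is irreducibility, so a Bezout argument is needed. An element
  \<open>d\<close> of least norm in the ideal generated by \<open>q\<close> and \<open>a\<close>
  divides both; in \<open>q = d * s\<close> a unit \<open>s\<close> would make \<open>q\<close>
  divide \<open>a\<close>, hence \<open>d\<close> is a unit.\<close>

lemma gprime_invertible:
  assumes "gprime q" "a \<in> Zi" "\<not> gdvd q a"
  obtains u where "u \<in> Zi" "scong Zi q (u * a) 1"
proof -
  have q: "q \<in> Zi" "q \<noteq> 0" "\<not> gunit q" using assms(1) by (auto simp: gprime_def)
  define I where "I = {u * q + w * a | u w. u \<in> Zi \<and> w \<in> Zi}"
  have II: "u * q + w * a \<in> I" if "u \<in> Zi" "w \<in> Zi" for u w using that unfolding I_def by blast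
  have qI: "q \<in> I" using II[of 1 0] by simp
  have aI: "a \<in> I" using II[of 0 1] by simp
  have IZ: "I \<subseteq> Zi" using q assms(2) by (auto simp: I_def)
  obtain d where d: "d \<in> I" "d \<noteq> 0" and
    min: "\<And>e. e \<in> I \<Longrightarrow> e \<noteq> 0 \<Longrightarrow> nat (gnorm d) \<le> nat (gnorm e)"
    using ex_has_least_nat[of "\<lambda>d. d \<in> I \<and> d \<noteq> 0" q "\<lambda>d. nat (gnorm d)"] qI q(2) by blast
  have dZ: "d \<in> Zi" using d IZ by blast
  have dvd: "gdvd d e" if e: "e \<in> I" for e
  proof -
    obtain t where t: "t \<in> Zi" "gnorm (e - d * t) < gnorm d"
      using Zi_division[of e d] e d IZ by blast
    obtain u w u' w' where *: "u \<in> Zi" "w \<in> Zi" "u' \<in> Zi" "w' \<in> Zi" "e = u * q + w * a" "d = u' * q + w' * a"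
      using e d unfolding I_def by blast
    have "e - d * t = (u - u' * t) * q + (w - w' * t) * a" using * by (simp add: algebra_simps)
    then have "e - d * t \<in> I" using II[of "u - u' * t" "w - w' * t"] * t by simp
    then have "e - d * t = 0" using min t(2) gnorm_nonneg by (metis nat_mono_iff linorder_not_less order_le_less_trans)
    then show ?thesis unfolding gdvd_def using t by auto
  qed
  obtain s where s: "s \<in> Zi" "q = d * s" using dvd[OF qI] by (auto simp: gdvd_def)
  then have "gunit d \<or> gunit s" using assms(1) dZ by (auto simp: gprime_def)
  moreover have "\<not> gunit s"
  proof
    assume "gunit s"
    then obtain v where v: "v \<in> Zi" "s * v = 1" by (auto simp: gunit_def)
    obtain b where b: "b \<in> Zi" "a = d * b" using dvd[OF aI] by (auto simp: gdvd_def)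
    have "a = q * (v * b)" using v b s by (simp add: algebra_simps)
    then show False using assms(3) v b unfolding gdvd_def by force
  qed
  ultimately obtain v where v: "v \<in> Zi" "d * v = 1" by (auto simp: gunit_def)
  obtain u w where *: "u \<in> Zi" "w \<in> Zi" "d = u * q + w * a" using d unfolding I_def by blast
  have "w * v * a - 1 = q * (- (u * v))" using v * by (simp add: algebra_simps)
  then have "scong Zi q (w * v * a) 1" unfolding scong_def using v *
    by (intro bexI[of _ "- (u * v)"]) auto
  then show ?thesis using that[of "w * v"] v * by simp
qed

lemma gprime_dvd_mult:
  assumes "gprime q" "a \<in> Zi" "b \<in> Zi" "gdvd q (a * b)"
  shows "gdvd q a \<or> gdvd q b"
proof (rule ccontr)
  assume n: "\<not> ?thesis"
  then obtain u where u: "u \<in> Zi" "scong Zi q (u * a) 1" using gprime_invertible assms by blast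
  have "scong Zi q (a * b) (a * 0)" using assms(4) by (simp add: scong_def gdvd_def)
  then have "scong Zi q b 0" by (rule Zi.scong_cancel[OF _ u(2)]) (use u assms in auto)
  then show False using n by (simp add: scong_def gdvd_def)
qed

text \<open>Guarantees that the \<open>SOME\<close> in \<open>quartic_symp\<close> picks an actual
  factorization. Proper factors have norm at least 2, so the norm decreases.\<close>

lemma gprime_factorization_exists:
  assumes "z \<in> Zi" "z \<noteq> 0" "\<not> gunit z"
  shows "\<exists>fs. (\<forall>q\<in>set fs. gprime q) \<and> prod_list fs = z"
  using assms
proof (induction "nat (gnorm z)" arbitrary: z rule: less_induct)
  case less
  show ?case
  proof (cases "gprime z")
    case True
    then show ?thesis by (intro exI[of _ "[z]"]) auto
  next
    case False
    then obtain a b where ab: "a \<in> Zi" "b \<in> Zi" "z = a * b" "\<not> gunit a" "\<not> gunit b"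
      using less.prems by (auto simp: gprime_def)
    have nz: "a \<noteq> 0" "b \<noteq> 0" using ab less.prems by auto
    have "gnorm a \<noteq> 0" "gnorm b \<noteq> 0" "gnorm a \<noteq> 1" "gnorm b \<noteq> 1"
      using ab nz gnorm_eq_0_iff[of a] gnorm_eq_0_iff[of b] gunit_iff[of a] gunit_iff[of b] by auto
    then have "gnorm a > 1" "gnorm b > 1"
      using gnorm_nonneg[of a] gnorm_nonneg[of b] by linarith+
    moreover have "gnorm z = gnorm a * gnorm b" using ab gnorm_mult by simp
    ultimately have "gnorm a < gnorm z" "gnorm b < gnorm z" by simp_all
    then have "nat (gnorm a) < nat (gnorm z)" "nat (gnorm b) < nat (gnorm z)"
      using gnorm_nonneg[of a] gnorm_nonneg[of b] by linarith+
    then obtain fs gs where "(\<forall>q\<in>set fs. gprime q) \<and> prod_list fs = a" "(\<forall>q\<in>set gs. gprime q) \<and> prod_list gs = b"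
      using less.hyps ab nz by meson
    then show ?thesis using ab by (intro exI[of _ "fs @ gs"]) auto
  qed
qed

text \<open>Covers every list that \<open>SOME\<close> could pick. The norms are greater than 1 and
  multiply to p^2, so there are at most two factors. If p itself is irreducible and p = 1 (mod 4),
  then p divides some (y+i)(y-i) but neither factor, whose imaginary part is 1 or -1. With two
  factors, p is a sum of two squares, so p is not 3 (mod 4).\<close>

lemma prime_gprime_factorization:
  assumes "prime p" "odd p" "\<forall>q\<in>set fs. gprime q" "prod_list fs = of_nat p"
  shows "(fs = [of_nat p] \<and> p mod 4 = 3) \<or>
    (\<exists>q. fs = [q, cnj q] \<and> gnorm q = int p \<and> p mod 4 = 1)"
proof -
  have gt: "gnorm q > 1" if "q \<in> set fs" for q
  proof -
    have "q \<in> Zi" "q \<noteq> 0" "\<not> gunit q" using assms(3) that by (auto simp: gprime_def)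
    then show ?thesis using gnorm_eq_0_iff[of q] gunit_iff[of q] gnorm_nonneg[of q] by linarith
  qed
  have cl: "prod_list l \<in> Zi" if "set l \<subseteq> set fs" for l
    using that assms(3) by (induction l) (auto simp: gprime_def)
  have p: "p > 2" using assms prime_ge_2_nat[of p] by (cases "p = 2") auto
  have m4: "p mod 4 = 1 \<or> p mod 4 = 3" using assms(2) by presburger
  show ?thesis
  proof (cases fs)
    case Nil
    then show ?thesis using assms(4) p by auto
  next
    case q: (Cons q fs')
    show ?thesis
    proof (cases fs')
      case Nil
      then have fs: "fs = [of_nat p]" using q assms(4) by simp
      then have gp: "gprime (of_nat p)" using assms(3) by simp
      have "p mod 4 \<noteq> 1"
      proof
        assume p1: "p mod 4 = 1"
        have "even ((p - 1) div 2)" using p1 by presburger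
        then have "[Legendre (-1) (int p) = 1] (mod int p)"
          using euler_criterion[OF assms(1) p, of "-1"] by simp
        moreover have "\<not> [- 1 = 1 :: int] (mod int p)" "\<not> [0 = 1 :: int] (mod int p)"
          using p zdvd_imp_le[of "int p" 2] assms(1) by (auto simp: cong_iff_dvd_diff)
        ultimately have "QuadRes (int p) (-1)" unfolding Legendre_def by (auto split: if_splits)
        then obtain y where "[y\<^sup>2 = -1] (mod int p)" by (auto simp: QuadRes_def)
        then have "scong Zi (of_nat p) (of_int (y\<^sup>2)) (of_int (-1))" by (rule Zi.scong_of_int)
        moreover have "(of_int y + \<i>) * (of_int y - \<i>) = of_int (y\<^sup>2) - of_int (-1)"
          by (simp add: power2_eq_square algebra_simps)
        ultimately have "gdvd (of_nat p) ((of_int y + \<i>) * (of_int y - \<i>))"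
          by (simp only: scong_def gdvd_def)
        then have "gdvd (of_nat p) (of_int y + \<i>) \<or> gdvd (of_nat p) (of_int y - \<i>)"
          using gprime_dvd_mult[OF gp] by simp
        then obtain z where z: "z \<in> Zi" "of_int y + \<i> = of_nat p * z \<or> of_int y - \<i> = of_nat p * z"
          by (auto simp: gdvd_def)
        obtain k where "Im z = of_int k" using z by (auto simp: Zi_def elim!: Ints_cases)
        then have "1 = real p * of_int k \<or> -1 = real p * of_int k"
          using z(2) by (auto dest!: arg_cong[of _ _ Im])
        then have "1 = int p * k \<or> -1 = int p * k"
          by (metis of_int_eq_iff of_int_mult of_int_of_nat_eq of_int_1 of_int_minus)
        then have "int p dvd 1" by (metis dvd_minus_iff dvd_triv_left)
        then show False using p by simp
      qed
      then show ?thesis using fs m4 by blast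
    next
      case q': (Cons q' r)
      have Zi: "q \<in> Zi" "q' \<in> Zi" "prod_list r \<in> Zi" using q q' cl[of "[q]"] cl[of "[q']"] cl[of r] by auto
      have eq: "q * (q' * prod_list r) = of_nat p" using q q' assms(4) by simp
      then have nn: "gnorm q * (gnorm q' * gnorm (prod_list r)) = (int p)\<^sup>2"
        using Zi by (metis gnorm_mult gnorm_of_nat Zi.mult_closed)
      have g1: "gnorm q > 1" "gnorm q' > 1" using gt q q' by auto
      have dq: "gnorm x = 1 \<or> gnorm x = int p \<or> gnorm x = (int p)\<^sup>2" if "gnorm x dvd (int p)\<^sup>2" for x
      proof -
        have "prime (int p)" using assms(1) by simp
        then obtain i where "i \<le> 2" "normalize (gnorm x) = int p ^ i"
          using \<open>gnorm x dvd (int p)\<^sup>2\<close> by (rule divides_primepow)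
        moreover from this have "i = 0 \<or> i = 1 \<or> i = 2" by linarith
        ultimately show ?thesis by auto
      qed
      have q1: "gnorm q = int p"
      proof -
        have "gnorm q \<noteq> (int p)\<^sup>2"
        proof
          assume "gnorm q = (int p)\<^sup>2"
          then have "gnorm q' * gnorm (prod_list r) = 1" using nn p by simp
          then show False using g1 zmult_eq_1_iff by auto
        qed
        moreover have "gnorm q dvd (int p)\<^sup>2" using nn by (metis dvd_triv_left)
        ultimately show ?thesis using dq[of q] g1 by auto
      qed
      then have n2: "gnorm q' * gnorm (prod_list r) = int p" using nn p by (simp add: power2_eq_square)
      have q'1: "gnorm q' = int p"
      proof -
        have "gnorm q' dvd int p" using n2 by (metis dvd_triv_left)
        moreover have "prime (int p)" using assms(1) by simp
        ultimately show ?thesis using g1 unfolding prime_int_iff by (metis gnorm_nonneg less_irrefl)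
      qed
      then have r1: "gnorm (prod_list r) = 1" using n2 p by simp
      have "r = []"
      proof (cases r)
        case (Cons x r')
        have "x \<in> Zi" "prod_list r' \<in> Zi" "gnorm x > 1" using q q' Cons cl[of "[x]"] cl[of r'] gt by auto
        then show ?thesis using r1 Cons gnorm_mult[of x "prod_list r'"] zmult_eq_1_iff by auto
      qed
      have nz: "q \<noteq> 0" using q1 p by (auto simp: gnorm_def)
      have "q * q' = q * cnj q" using \<open>r = []\<close> eq mult_cnj_gnorm[OF Zi(1)] q1 by simp
      then have "q' = cnj q" using nz by simp
      obtain x y where xy: "Re q = of_int x" "Im q = of_int y"
        using Zi by (auto simp: Zi_def elim!: Ints_cases)
      then have "gnorm q = x\<^sup>2 + y\<^sup>2" by (simp add: gnorm_def flip: of_int_power of_int_add)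
      then have "int p = x\<^sup>2 + y\<^sup>2" using q1 by simp
      moreover have sq: "z\<^sup>2 mod 4 = 0 \<or> z\<^sup>2 mod 4 = 1" for z :: int
      proof (cases "even z")
        case True then show ?thesis by (auto elim!: evenE simp: power2_eq_square)
      next
        case False then obtain w where "z = 2 * w + 1" by (auto elim: oddE)
        then have "z\<^sup>2 = 1 + 4 * (w\<^sup>2 + w)" by (simp add: power2_eq_square algebra_simps)
        then show ?thesis by (simp only: mod_mult_self2) simp
      qed
      moreover from sq[of x] sq[of y] have "(x\<^sup>2 + y\<^sup>2) mod 4 \<noteq> 3"
        unfolding mod_add_eq[of "x\<^sup>2" 4 "y\<^sup>2", symmetric] by auto
      ultimately have "int p mod 4 \<noteq> 3" by simp
      then have "p mod 4 = 1" using m4 by presburger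
      then show ?thesis using q q' \<open>r = []\<close> \<open>q' = cnj q\<close> q1 by blast
    qed
  qed
qed

section \<open>The quartic symbol\<close>

lemma scong_Zi_cnj:
  assumes "scong Zi m x y" shows "scong Zi (cnj m) (cnj x) (cnj y)"
proof -
  obtain z where "z \<in> Zi" "x - y = m * z" using assms by (auto simp: scong_def)
  then have "cnj z \<in> Zi" "cnj x - cnj y = cnj m * cnj z"
    by (simp_all flip: complex_cnj_diff complex_cnj_mult)
  then show ?thesis unfolding scong_def by blast
qed

text \<open>Taking norms in \<open>n = q * z\<close> gives n^2 = p N(z). Thus a congruence of
  rational integers modulo one prime above p already holds modulo p.\<close>

lemma scong_Zi_gnorm:
  assumes "scong Zi q (of_int n) 0" "q \<in> Zi" "gnorm q = int p" "prime p"
  shows "int p dvd n"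
proof -
  obtain z where z: "z \<in> Zi" "of_int n = q * z" using assms(1) by (auto simp: scong_def)
  then have "n\<^sup>2 = int p * gnorm z" using gnorm_mult[of q z] assms by (metis gnorm_of_int)
  then have "int p dvd n\<^sup>2" by simp
  then show ?thesis using assms(4) by (metis prime_dvd_power prime_nat_int_transfer)
qed

lemma scong_Zi_of_nat:
  assumes "scong Zi (of_nat p) (of_int n) 0"
  shows "int p dvd n"
proof -
  obtain z where z: "z \<in> Zi" "of_int n = of_nat p * z" using assms by (auto simp: scong_def)
  obtain k where "Re z = of_int k" using z by (auto simp: Zi_def elim!: Ints_cases)
  then have "real_of_int n = of_int (int p * k)"
    using z(2) by (auto dest!: arg_cong[of _ _ Re])
  then show ?thesis by (simp only: of_int_eq_iff) simp
qed

text \<open>Shows that the \<open>THE\<close> in \<open>quartic_sym\<close> is well defined.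
  Existence: x^4 - 1 splits into linear factors, and \<open>q\<close> divides one of them.
  Uniqueness: two distinct candidates differ by an element of norm 1, 2 or 4, whereas the norm of
  \<open>q\<close> is odd and greater than 1.\<close>

lemma quartic_sym_cong:
  assumes "gprime q" "odd (gnorm q)" "\<alpha> \<in> Zi"
    and "scong Zi q (\<alpha> ^ (4 * nat ((gnorm q - 1) div 4))) 1"
  shows "quartic_sym \<alpha> q \<in> {0, 1, \<i>, -1, -\<i>}"
    and "scong Zi q (quartic_sym \<alpha> q) (\<alpha> ^ nat ((gnorm q - 1) div 4))"
proof -
  let ?b = "\<alpha> ^ nat ((gnorm q - 1) div 4)"
  let ?P = "\<lambda>r. r \<in> {0, 1, \<i>, -1, -\<i>} \<and> gcong q r ?b"
  have q: "q \<in> Zi" "\<not> gunit q" using assms(1) by (auto simp: gprime_def)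
  have b: "?b \<in> Zi" using assms(3) by simp
  have "?b ^ 4 - 1 = (?b - 1) * ((?b - \<i>) * ((?b - (-1)) * (?b - (-\<i>))))"
    by (simp add: algebra_simps power4_eq_xxxx)
  moreover have "gdvd q (?b ^ 4 - 1)"
    using assms(4) by (simp add: scong_def gdvd_def mult.commute flip: power_mult)
  ultimately have "gdvd q ((?b - 1) * ((?b - \<i>) * ((?b - (-1)) * (?b - (-\<i>)))))" by simp
  then have "gdvd q (?b - 1) \<or> gdvd q (?b - \<i>) \<or> gdvd q (?b - (-1)) \<or> gdvd q (?b - (-\<i>))"
    by (metis (no_types, lifting) gprime_dvd_mult[OF assms(1)] b i_in_Zi
        Zi.one_closed Zi.diff_closed Zi.mult_closed Zi.uminus_closed)
  then have "\<exists>r\<in>{1, \<i>, -1, -\<i>}. scong Zi q ?b r" by (simp add: gdvd_def scong_def)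
  then have ex: "\<exists>r. ?P r" unfolding gcong_eq_scong using Zi.scong_sym by blast
  have uniq: "r = s" if "?P r" "?P s" for r s
  proof (rule ccontr)
    assume "r \<noteq> s"
    have "scong Zi q r s" using that Zi.scong_sym Zi.scong_trans unfolding gcong_eq_scong by blast
    then obtain z where z: "z \<in> Zi" "r - s = q * z" by (auto simp: scong_def)
    then have "gnorm q dvd gnorm (r - s)" using q gnorm_mult[of q z] by simp
    moreover have "gnorm (r - s) dvd 4"
      using that \<open>r \<noteq> s\<close> by (auto simp: gnorm_def)
    ultimately have "gnorm q dvd 2 * 2" by (metis dvd_trans mult_2 numeral_Bit0)
    moreover have "coprime (gnorm q) 2" using assms(2) by simp
    ultimately have "gnorm q dvd 1" by (metis coprime_dvd_mult_left_iff coprime_common_divisor dvd_refl is_unit_gcd coprime_iff_gcd_eq_1)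
    then have "gnorm q = 1" using gnorm_nonneg[of q] by simp
    then show False using q gunit_iff by blast
  qed
  from ex obtain r where "?P r" by blast
  then have "?P (quartic_sym \<alpha> q)"
    unfolding quartic_sym_def by (rule theI) (use uniq \<open>?P r\<close> in blast)
  then show "quartic_sym \<alpha> q \<in> {0, 1, \<i>, -1, -\<i>}"
    "scong Zi q (quartic_sym \<alpha> q) ?b" by (auto simp: gcong_eq_scong)
qed

lemma i_power_mod4: "p mod 4 = 1 \<Longrightarrow> \<i> ^ p = \<i>" "p mod 4 = 3 \<Longrightarrow> \<i> ^ p = - \<i>"
proof -
  have "\<i> ^ p = \<i> ^ (p mod 4)"
    using power_add[of \<i> "4 * (p div 4)" "p mod 4"] by (simp add: power_mult)
  then show "p mod 4 = 1 \<Longrightarrow> \<i> ^ p = \<i>" "p mod 4 = 3 \<Longrightarrow> \<i> ^ p = - \<i>"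
    by (simp_all add: numeral_3_eq_3)
qed

locale complex_subring = subring S for S :: "complex set" +
  assumes i_closed [simp]: "\<i> \<in> S"
begin

text \<open>The p-th power therefore fixes a+i if p = 1 (mod 4) and conjugates it if p = 3 (mod
  4).\<close>

lemma scong_frobenius_Gauss:
  assumes "prime p"
  shows "scong S (of_nat p) ((of_nat a + \<i>) ^ p) (of_nat a + \<i> ^ p)"
    and "scong S (of_nat p) ((of_nat a - \<i>) ^ p) (of_nat a + (- \<i>) ^ p)"
proof -
  have "scong S (of_nat p) ((of_nat a + z) ^ p) (of_nat a + z ^ p)" if "z \<in> S" for z
    using scong_trans[OF scong_frobenius[OF assms, of "of_nat a" z]
        scong_add[OF scong_fermat[OF assms] scong_refl]] that by simp
  from this[of \<i>] this[of "- \<i>"]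
  show "scong S (of_nat p) ((of_nat a + \<i>) ^ p) (of_nat a + \<i> ^ p)"
    "scong S (of_nat p) ((of_nat a - \<i>) ^ p) (of_nat a + (- \<i>) ^ p)" by simp_all
qed

end

interpretation Zi: complex_subring Zi
  by unfold_locales simp

lemma Gauss_inverse:
  assumes "[(a\<^sup>2 + 1) * M = 1] (mod p)"
  shows "scong Zi (of_nat p) ((of_nat M * (of_nat a - \<i>)) * (of_nat a + \<i>)) 1"
    and "scong Zi (of_nat p) ((of_nat M * (of_nat a + \<i>)) * (of_nat a - \<i>)) 1"
proof -
  have "[int ((a\<^sup>2 + 1) * M) = int 1] (mod int p)" using assms by (simp only: cong_int_iff)
  then have "scong Zi (of_nat p) (of_int (int ((a\<^sup>2 + 1) * M))) (of_int (int 1))" by (rule Zi.scong_of_int)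
  moreover have "of_int (int ((a\<^sup>2 + 1) * M)) = (of_nat M * (of_nat a - \<i>)) * (of_nat a + \<i>)"
    by (simp add: algebra_simps power2_eq_square)
  ultimately show "scong Zi (of_nat p) ((of_nat M * (of_nat a - \<i>)) * (of_nat a + \<i>)) 1" by simp
  then show "scong Zi (of_nat p) ((of_nat M * (of_nat a + \<i>)) * (of_nat a - \<i>)) 1"
    by (simp add: mult_ac)
qed

lemma quartic_symp_cases:
  assumes "prime p" "odd p" "p mod 4 = r"
  shows "r = 3 \<Longrightarrow> gprime (of_nat p) \<and> quartic_symp \<gamma> p = quartic_sym \<gamma> (of_nat p)"
    and "r = 1 \<Longrightarrow> \<exists>q. gprime q \<and> gprime (cnj q) \<and> gnorm q = int p \<and>
       quartic_symp \<gamma> p = quartic_sym \<gamma> q * quartic_sym \<gamma> (cnj q)"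
proof -
  define fs where "fs = (SOME fs. (\<forall>q\<in>set fs. gprime q) \<and> prod_list fs = of_nat p)"
  have "p > 1" using assms prime_gt_1_nat by blast
  then have "(int p)\<^sup>2 \<noteq> 1" using one_less_power[of "int p" 2] by linarith
  with \<open>p > 1\<close> have "\<exists>fs. (\<forall>q\<in>set fs. gprime q) \<and> prod_list fs = (of_nat p :: complex)"
    by (intro gprime_factorization_exists) (auto simp: gunit_iff)
  then have "(\<forall>q\<in>set fs. gprime q) \<and> prod_list fs = of_nat p"
    unfolding fs_def by (rule someI_ex)
  then have fs: "\<forall>q\<in>set fs. gprime q" "prod_list fs = of_nat p" by blast+
  have sy: "quartic_symp \<gamma> p = prod_list (map (quartic_sym \<gamma>) fs)"
    by (simp add: quartic_symp_def fs_def)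
  note * = prime_gprime_factorization[OF assms(1,2) fs]
  show "r = 3 \<Longrightarrow> gprime (of_nat p) \<and> quartic_symp \<gamma> p = quartic_sym \<gamma> (of_nat p)"
    using * assms(3) fs sy by auto
  show "r = 1 \<Longrightarrow> \<exists>q. gprime q \<and> gprime (cnj q) \<and> gnorm q = int p \<and>
       quartic_symp \<gamma> p = quartic_sym \<gamma> q * quartic_sym \<gamma> (cnj q)"
    using * assms(3) fs sy by auto
qed

text \<open>The symbol at \<open>cnj q\<close> satisfies a congruence modulo \<open>cnj q\<close>;
  its conjugate is one modulo \<open>q\<close> with a-i in place of a+i. Since the two symbols
  \<open>r1\<close>, \<open>r2\<close> have product \<open>\<rho>\<close> and \<open>r2\<close> has
  modulus 1, \<open>r1 = \<rho> * cnj r2\<close>, and both congruences combine modulo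
  \<open>q\<close>.\<close>

lemma quartic_symp_split:
  assumes p: "prime p" "p mod 4 = 1" "[(a\<^sup>2 + 1) * M = 1] (mod p)"
    and g: "\<gamma> \<in> Zi" "scong Zi (of_nat p) \<gamma> (of_nat a + \<i>)"
    and r: "quartic_symp \<gamma> p = \<rho>" "\<rho> \<in> {\<i>, - \<i>}"
  obtains q where "q \<in> Zi" "gnorm q = int p"
    "scong Zi q ((of_nat a + \<i>) ^ ((p - 1) div 4)) (\<rho> * (of_nat a - \<i>) ^ ((p - 1) div 4))"
proof -
  let ?a = "of_nat a + \<i>" and ?m = "(p - 1) div 4"
  have odd: "odd p" using p by presburger
  obtain q where q: "gprime q" "gprime (cnj q)" "gnorm q = int p"
    "quartic_symp \<gamma> p = quartic_sym \<gamma> q * quartic_sym \<gamma> (cnj q)"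
    using quartic_symp_cases(2)[OF p(1) odd p(2) refl] by blast
  have qZ: "q \<in> Zi" using q by (simp add: gprime_def)
  have qq: "q * cnj q = of_nat p" using mult_cnj_gnorm[OF qZ] q by simp
  have p0: "p > 0" using p prime_gt_0_nat by blast
  have e: "nat ((gnorm q - 1) div 4) = ?m" "nat ((gnorm (cnj q) - 1) div 4) = ?m"
    using q p0 by (simp_all add: zdiv_int of_nat_diff)
  have m4: "4 * ?m = p - 1" using p(2) by presburger
  have "scong Zi (of_nat p) (?a ^ p) ?a"
    using Zi.scong_frobenius_Gauss(1)[OF p(1), of a] i_power_mod4(1)[OF p(2)] by simp
  then have "scong Zi (of_nat p) (?a * ?a ^ (4 * ?m)) (?a * 1)"
    using m4 p0 by (simp add: power_Suc[symmetric])
  then have f: "scong Zi (of_nat p) (?a ^ (4 * ?m)) 1"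
    by (rule Zi.scong_cancel[OF _ Gauss_inverse(1)[OF p(3)]]) simp_all
  have f: "scong Zi (of_nat p) (\<gamma> ^ (4 * ?m)) 1"
    using Zi.scong_trans[OF Zi.scong_power[OF g(2) g(1)] f] by simp
  have mq: "scong Zi q x y" "scong Zi (cnj q) x y" if "scong Zi (of_nat p) x y" for x y
    using Zi.scong_modulus_mult[of q "cnj q" x y] Zi.scong_modulus_mult[of "cnj q" q x y]
      that qZ qq by (simp_all add: mult.commute)
  have ga: "scong Zi (of_nat p) (\<gamma> ^ ?m) (?a ^ ?m)"
    using g by (intro Zi.scong_power) simp_all
  define r1 r2 where "r1 = quartic_sym \<gamma> q" and "r2 = quartic_sym \<gamma> (cnj q)"
  have o: "odd (gnorm q)" "odd (gnorm (cnj q))" using q(3) odd by simp_all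
  have r1: "r1 \<in> {0, 1, \<i>, -1, -\<i>}" "scong Zi q r1 (\<gamma> ^ ?m)"
    unfolding r1_def using quartic_sym_cong[OF q(1) o(1) g(1)] e f mq by simp_all
  have r2: "r2 \<in> {0, 1, \<i>, -1, -\<i>}" "scong Zi (cnj q) r2 (\<gamma> ^ ?m)"
    unfolding r2_def using quartic_sym_cong[OF q(2) o(2) g(1)] e f mq by simp_all
  have r12: "r1 * r2 = \<rho>" using q(4) r by (simp add: r1_def r2_def)
  have rZ: "r1 \<in> Zi" "r2 \<in> Zi" "\<rho> \<in> Zi" using r1(1) r2(1) r(2) by auto
  have "r2 \<noteq> 0" using r12 r(2) by auto
  then have "r2 * cnj r2 = 1" using r2(1) by auto
  then have n: "r1 = \<rho> * cnj r2" using r12 by (metis mult.assoc mult.right_neutral)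
  have 1: "scong Zi q (?a ^ ?m) r1"
    using r1(2) mq(1)[OF ga] Zi.scong_sym Zi.scong_trans by blast
  have "scong Zi (cnj q) r2 (?a ^ ?m)"
    using r2(2) mq(2)[OF ga] Zi.scong_trans by blast
  then have 2: "scong Zi q (cnj r2) ((of_nat a - \<i>) ^ ?m)"
    using scong_Zi_cnj[of "cnj q" r2 "?a ^ ?m"] by simp
  have "scong Zi q (?a ^ ?m) (\<rho> * (of_nat a - \<i>) ^ ?m)"
    using Zi.scong_trans[OF 1[unfolded n] Zi.scong_lmult[OF 2 rZ(3)]] .
  then show ?thesis using that qZ q(3) by blast
qed

text \<open>Here p is itself a Gaussian prime of norm p^2, and the exponent (p^2-1)/4 is
  \<open>k\<close> = (p-1)m with m = (p+1)/4. As k + m = pm, multiplying by the m-th power of a+i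
  produces ((a+i)^p)^m, and Frobenius conjugates the base.\<close>

lemma quartic_symp_inert:
  assumes p: "prime p" "p mod 4 = 3" "[(a\<^sup>2 + 1) * M = 1] (mod p)"
    and g: "\<gamma> \<in> Zi" "scong Zi (of_nat p) \<gamma> (of_nat a + \<i>)"
  shows "scong Zi (of_nat p) (quartic_symp \<gamma> p * (of_nat a + \<i>) ^ ((p + 1) div 4))
     ((of_nat a - \<i>) ^ ((p + 1) div 4))"
proof -
  let ?a = "of_nat a + \<i>" and ?b = "of_nat a - \<i>" and ?m = "(p + 1) div 4"
  have odd: "odd p" using p by presburger
  have q: "gprime (of_nat p)" "quartic_symp \<gamma> p = quartic_sym \<gamma> (of_nat p)"
    using quartic_symp_cases(1)[OF p(1) odd p(2) refl] by blast+
  have p0: "p > 0" using p prime_gt_0_nat by blast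
  have m4: "4 * ?m = p + 1" using p(2) by presburger
  define k where "k = (p - 1) * ?m"
  have k4: "4 * k = p\<^sup>2 - 1" "k + ?m = p * ?m"
  proof -
    show "k + ?m = p * ?m" using p0 by (cases p) (simp_all add: k_def)
    have "4 * k = (p - 1) * (4 * ?m)" by (simp add: k_def)
    also have "\<dots> = (p - 1) * (p + 1)" by (simp only: m4)
    finally have "4 * k = (p - 1) * (p + 1)" .
    then show "4 * k = p\<^sup>2 - 1" by (simp add: power2_eq_square algebra_simps diff_mult_distrib2)
  qed
  have e: "nat ((gnorm (of_nat p) - 1) div 4) = k"
  proof -
    have "(int p)\<^sup>2 - 1 = 4 * int k" using arg_cong[OF k4(1), of int] p0 by (simp add: of_nat_diff)
    then show ?thesis by simp
  qed
  have ab: "scong Zi (of_nat p) (?a ^ p) ?b" "scong Zi (of_nat p) (?b ^ p) ?a"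
    using Zi.scong_frobenius_Gauss[OF p(1), of a] i_power_mod4(2)[OF p(2)] odd
    by (simp_all add: power_minus_odd)
  have "scong Zi (of_nat p) (?a ^ (p * p)) (?b ^ p)"
    unfolding power_mult by (intro Zi.scong_power ab) simp_all
  also note ab(2)
  finally have "scong Zi (of_nat p) (?a * ?a ^ (4 * k)) (?a * 1)"
    using k4(1) p0 by (simp add: power_Suc[symmetric] power2_eq_square)
  then have f: "scong Zi (of_nat p) (?a ^ (4 * k)) 1"
    by (rule Zi.scong_cancel[OF _ Gauss_inverse(1)[OF p(3)]]) simp_all
  have f: "scong Zi (of_nat p) (\<gamma> ^ (4 * k)) 1"
    using Zi.scong_trans[OF Zi.scong_power[OF g(2) g(1)] f] by simp
  have ga: "scong Zi (of_nat p) (\<gamma> ^ k) (?a ^ k)"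
    using g by (intro Zi.scong_power) simp_all
  have o: "odd (gnorm (of_nat p))" using odd by simp
  have "scong Zi (of_nat p) (quartic_symp \<gamma> p) (\<gamma> ^ k)"
    using quartic_sym_cong(2)[OF q(1) o g(1)] e f q(2) by simp
  also note ga
  finally have "scong Zi (of_nat p) (?a ^ ?m * quartic_symp \<gamma> p) (?a ^ ?m * ?a ^ k)"
    by (rule Zi.scong_lmult) simp
  also have "?a ^ ?m * ?a ^ k = (?a ^ p) ^ ?m"
    by (simp only: power_add[symmetric] k4(2) add.commute[of ?m] power_mult)
  also have "scong Zi (of_nat p) \<dots> (?b ^ ?m)"
    by (intro Zi.scong_power ab) simp_all
  finally show ?thesis by (simp add: mult.commute)
qed

section \<open>The binomial sum in terms of a square root\<close>

context subring
begin

text \<open>The inverse is demanded explicitly and inside \<open>S\<close>, since \<open>S\<close>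
  modulo \<open>m\<close> need not be a domain.\<close>

definition sunit :: "'a \<Rightarrow> 'a \<Rightarrow> bool" where
  "sunit m z \<longleftrightarrow> z \<in> S \<and> (\<exists>w\<in>S. scong S m (w * z) 1)"

lemma sunit_cancel:
  "scong S m (z * x) (z * y) \<Longrightarrow> sunit m z \<Longrightarrow> x \<in> S \<Longrightarrow> y \<in> S \<Longrightarrow> scong S m x y"
  unfolding sunit_def using scong_cancel by blast

lemma sunitI: "scong S m (w * z) 1 \<Longrightarrow> w \<in> S \<Longrightarrow> z \<in> S \<Longrightarrow> sunit m z"
  unfolding sunit_def by blast

lemma sunit_mult: assumes "sunit m x" "sunit m y" shows "sunit m (x * y)"
proof -
  obtain u w where *: "u \<in> S" "w \<in> S" "scong S m (u * x) 1" "scong S m (w * y) 1" "x \<in> S" "y \<in> S"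
    using assms by (auto simp: sunit_def)
  have "scong S m ((u * x) * (w * y)) (1 * 1)" using * by (intro scong_mult) simp_all
  then have "scong S m ((u * w) * (x * y)) 1" by (simp add: mult_ac)
  then show ?thesis by (rule sunitI) (use * in simp_all)
qed

lemma sunit_power: "sunit m x \<Longrightarrow> sunit m (x ^ k)"
proof (induction k)
  case 0
  show ?case by (rule sunitI[of _ 1]) simp_all
qed (simp add: sunit_mult)

text \<open>Reduces a congruence to a polynomial identity: the difference of its sides is
  \<open>k\<close> times that of a known one.\<close>

lemma scong_linear:
  assumes "scong S m u w" "k \<in> S" "x - y = k * (u - w)"
  shows "scong S m x y"
proof -
  have "scong S m (k * (u - w)) (k * 0)" using assms by (intro scong_lmult) (simp_all add: scong_diff_0)
  then have "scong S m (x - y) 0" using assms(3) by simp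
  then show ?thesis by (simp only: scong_diff_0)
qed

lemma scong_of_nat: "[k = l] (mod p) \<Longrightarrow> scong S (of_nat p) (of_nat k) (of_nat l)"
  using scong_of_int[of "int k" "int l" p] by (simp add: cong_int_iff)

end

text \<open>\<open>M\<close> is the inverse of \<open>a\<^sup>2 + 1\<close>, \<open>v\<close> its square root, and \<open>\<chi>\<close> the quadratic character of \<open>M\<close>.\<close>
locale sqrt_setting = complex_subring S for S +
  fixes p a b M n :: nat and v :: complex and \<chi> :: complex
  assumes prime: "prime p" and p: "p = 2 * n + 1"
    and ab: "[a * b = 1] (mod p)"
    and NM: "[(a\<^sup>2 + 1) * M = 1] (mod p)"
    and v [simp]: "v \<in> S" and v2: "v * v = of_nat M"
    and chi: "scong S (of_nat p) (of_nat M ^ n) \<chi>" "\<chi> \<in> S"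
begin

abbreviation eqv (infix "\<doteq>" 50) where "x \<doteq> y \<equiv> scong S (of_nat p) x y"
abbreviation unit where "unit \<equiv> sunit (of_nat p)"
abbreviation "\<alpha> \<equiv> of_nat a + \<i>"
abbreviation "\<beta> \<equiv> of_nat a - \<i>"
abbreviation "A \<equiv> (1 + v) ^ n"
abbreviation "A' \<equiv> (1 - v) ^ n"

lemma NM': "(of_nat a * of_nat a + 1) * of_nat M \<doteq> 1"
  using scong_of_nat[OF NM] by (simp add: power2_eq_square algebra_simps)

lemma NM_v: "(of_nat a * of_nat a + 1) * (v * v) \<doteq> 1"
  using NM' by (simp add: v2)

lemma unit_a: "unit (of_nat a)"
  by (rule sunitI[of _ "of_nat b"]) (use scong_of_nat[OF ab] in \<open>simp_all add: mult.commute\<close>)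

lemma unit_2: "unit 2"
proof (rule sunitI[of _ "of_nat (n + 1)"])
  have "[(n + 1) * 2 = 1] (mod p)" using p by (simp add: cong_def mod_Suc)
  then show "of_nat (n + 1) * 2 \<doteq> 1" by (metis scong_of_nat of_nat_1 of_nat_mult of_nat_numeral)
qed simp_all

lemma unit_alpha: "unit \<alpha>"
  by (rule sunitI[of _ "of_nat M * \<beta>"], rule scong_linear[OF NM', of 1]) (simp_all add: algebra_simps)

lemma unit_v: "unit v"
  by (rule sunitI[of _ "(of_nat a * of_nat a + 1) * v"], rule scong_linear[OF NM_v, of 1])
    (simp_all add: algebra_simps)

text \<open>The left side is 1 - M, and 1 = (a^2+1)M modulo p. Since \<open>a\<close> and
  \<open>v\<close> are units, this also makes 1+v a unit.\<close>

lemma one_minus_M: "(1 - v) * (1 + v) \<doteq> (v * of_nat a)\<^sup>2"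
  by (rule scong_linear[OF scong_sym[OF NM_v], of 1]) (simp_all add: algebra_simps power2_eq_square)

lemma unit_1v: "unit (1 + v)"
proof -
  have "unit ((v * of_nat a)\<^sup>2)" by (intro sunit_power sunit_mult unit_v unit_a)
  then obtain w where w: "w \<in> S" "w * (v * of_nat a)\<^sup>2 \<doteq> 1" by (auto simp: sunit_def)
  have "w * ((1 - v) * (1 + v)) \<doteq> w * (v * of_nat a)\<^sup>2" by (rule scong_lmult[OF one_minus_M w(1)])
  from scong_trans[OF this w(2)] show ?thesis
    by (intro sunitI[of _ "w * (1 - v)"]) (use w in \<open>simp_all add: mult.assoc\<close>)
qed

lemma v_power_p: "v ^ p \<doteq> \<chi> * v"
proof -
  have "v ^ p = v * (v * v) ^ n" by (simp add: p power_mult power2_eq_square)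
  also have "\<dots> \<doteq> v * \<chi>" unfolding v2 by (intro scong_lmult chi v)
  finally show ?thesis by (simp add: mult.commute)
qed

lemma A_square: "A\<^sup>2 * (1 + v) \<doteq> 1 + \<chi> * v"
proof -
  have "A\<^sup>2 * (1 + v) = (1 + v) ^ p" by (simp add: p power_mult mult.commute flip: power_mult)
  also have "\<dots> \<doteq> 1 ^ p + v ^ p" by (intro scong_frobenius prime) simp_all
  also have "\<dots> \<doteq> 1 + \<chi> * v" by (intro scong_add v_power_p) simp_all
  finally show ?thesis .
qed

lemma even_power_v: "v ^ (2 * k) = of_nat M ^ k"
  by (simp add: power_mult power2_eq_square v2)

text \<open>The product is (1-M)^n = (a^2 M)^n = a^(p-1) M^n modulo p.\<close>

lemma A_A': "A * A' \<doteq> \<chi>"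
proof -
  have "A * A' = ((1 - v) * (1 + v)) ^ n" by (simp add: power_mult_distrib mult.commute)
  also have "\<dots> \<doteq> ((v * of_nat a)\<^sup>2) ^ n" by (intro scong_power one_minus_M) simp_all
  also have "\<dots> = of_nat M ^ n * of_nat a ^ (2 * n)"
    by (simp add: power_mult_distrib flip: power_mult even_power_v)
  also have "\<dots> \<doteq> \<chi> * 1"
  proof (intro scong_mult chi)
    have "of_nat a * of_nat a ^ (2 * n) \<doteq> of_nat a * 1"
      using scong_fermat[OF prime, of a] by (simp add: p)
    then show "of_nat a ^ (2 * n) \<doteq> 1" by (rule sunit_cancel[OF _ unit_a]) simp_all
  qed simp_all
  finally show ?thesis by simp
qed

text \<open>Now \<open>A^2\<close> and \<open>A * A'\<close> are both 1, so \<open>A\<close> and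
  \<open>A'\<close> are both inverses of \<open>A\<close>.\<close>

lemma A_eq_A': assumes "\<chi> = 1" shows "A \<doteq> A'"
proof -
  have "(1 + v) * A\<^sup>2 \<doteq> (1 + v) * 1" using A_square assms by (simp add: mult.commute)
  then have "A\<^sup>2 \<doteq> 1" by (rule sunit_cancel[OF _ unit_1v]) simp_all
  then have "A' * 1 \<doteq> A' * A\<^sup>2" by (intro scong_lmult scong_sym[where x = "A\<^sup>2"]) simp_all
  also have "A' * A\<^sup>2 = A * (A * A')" by (simp add: power2_eq_square)
  also have "\<dots> \<doteq> A * 1" using A_A' assms by (intro scong_lmult) simp_all
  finally show ?thesis by (simp add: scong_sym)
qed

text \<open>Multiplying v(A - A') by A(1+v) leaves only \<open>A^2 * (1 + v)\<close> and
  \<open>A * A'\<close>, which are known: v((1-v) + (1+v)) = 2v.\<close>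

lemma half_diff_cong:
  assumes "\<chi> = - 1" "2 * E = v * (A - A')" "E \<in> S"
  shows "E * (A * (1 + v)) \<doteq> v"
proof (rule sunit_cancel[OF _ unit_2])
  have "2 * (E * (A * (1 + v))) = (2 * E) * (A * (1 + v))" by (simp only: mult.assoc)
  also have "\<dots> = v * (A\<^sup>2 * (1 + v) - A * A' * (1 + v))"
    unfolding assms(2) by (simp add: algebra_simps power2_eq_square)
  also have "\<dots> \<doteq> v * ((1 + \<chi> * v) - \<chi> * (1 + v))"
    by (intro scong_lmult scong_diff A_square scong_mult A_A') (use chi in simp_all)
  also have "\<dots> = 2 * v" using assms(1) by (simp add: algebra_simps)
  finally show "2 * (E * (A * (1 + v))) \<doteq> 2 * v" .
qed (use assms in simp_all)

text \<open>From \<open>\<alpha> * \<beta> * v^2\<close> = 1 modulo p and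
  \<open>\<alpha> - \<beta> = 2 * \<i>\<close> one gets \<open>\<alpha>^2 * v^2 - 1\<close> =
  \<open>2 * \<i> * \<alpha> * v^2\<close>; the cross term of the square supplies the summand
  \<open>2 * \<i> * \<alpha> * v\<close>.\<close>

lemma square_identity: "(\<alpha> * v + \<i>)\<^sup>2 \<doteq> 2 * \<i> * \<alpha> * v * (1 + v)"
  by (rule scong_linear[OF NM_v, of 1])
    (simp_all add: algebra_simps power2_eq_square)

lemma square_identity': "(- \<alpha> * v + \<i>)\<^sup>2 \<doteq> 2 * \<i> * \<alpha> * v * (v - 1)"
  by (rule scong_linear[OF NM_v, of 1])
    (simp_all add: algebra_simps power2_eq_square)

text \<open>Since 2i = (1+i)^2, the powers are (1+i)^(p-1) and (1+i)^(p+1), to which Frobenius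
  applies.\<close>

lemma two_i_power: "p mod 4 = 1 \<Longrightarrow> (2 * \<i>) ^ n \<doteq> 1" "p mod 4 = 3 \<Longrightarrow> (2 * \<i>) ^ (n + 1) \<doteq> 2"
proof -
  have sq: "(2 * \<i>) = (1 + \<i>)\<^sup>2" by (simp add: power2_eq_square algebra_simps)
  have f: "(1 + \<i>) ^ p \<doteq> 1 + \<i> ^ p"
    using scong_frobenius[OF prime, of 1 \<i>] by simp
  have u: "unit (1 + \<i>)"
  proof -
    obtain w where "w \<in> S" "w * 2 \<doteq> 1" using unit_2 by (auto simp: sunit_def)
    then show ?thesis by (intro sunitI[of _ "w * (1 - \<i>)"]) (simp_all add: algebra_simps)
  qed
  show "(2 * \<i>) ^ n \<doteq> 1" if "p mod 4 = 1"
  proof (rule sunit_cancel[OF _ u])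
    have "(1 + \<i>) * (2 * \<i>) ^ n = (1 + \<i>) ^ p" unfolding sq by (simp add: p flip: power_mult)
    then show "(1 + \<i>) * (2 * \<i>) ^ n \<doteq> (1 + \<i>) * 1" using f that by (simp add: i_power_mod4)
  qed simp_all
  show "(2 * \<i>) ^ (n + 1) \<doteq> 2" if "p mod 4 = 3"
  proof -
    have "(2 * \<i>) ^ (n + 1) = (1 + \<i>) * (1 + \<i>) ^ p"
      unfolding sq power_mult[symmetric] power_Suc[symmetric] by (simp add: p)
    also have "\<dots> \<doteq> (1 + \<i>) * (1 - \<i>)" using f that by (intro scong_lmult) (simp_all add: i_power_mod4)
    also have "(1 + \<i>) * (1 - \<i>) = 2" by (simp add: algebra_simps)
    finally show ?thesis .
  qed
qed

text \<open>For a nonresidue \<open>M\<close>, Frobenius sends \<open>v\<close> to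
  \<open>-v\<close>. The image is \<open>- \<alpha> * v + \<i>\<close> if p = 1 (mod 4) and
  \<open>- \<beta> * v - \<i>\<close> if p = 3 (mod 4).\<close>

lemma frobenius_linear:
  assumes "\<chi> = -1"
  shows "(\<alpha> * v + \<i>) ^ p \<doteq> - (of_nat a + \<i> ^ p) * v + \<i> ^ p"
proof -
  have "(\<alpha> * v + \<i>) ^ p \<doteq> (\<alpha> * v) ^ p + \<i> ^ p" by (intro scong_frobenius prime) simp_all
  also have "(\<alpha> * v) ^ p = \<alpha> ^ p * v ^ p" by (simp add: power_mult_distrib)
  also have "\<alpha> ^ p * v ^ p + \<i> ^ p \<doteq> (of_nat a + \<i> ^ p) * (\<chi> * v) + \<i> ^ p"
    by (intro scong_add scong_mult scong_frobenius_Gauss(1) prime v_power_p scong_refl) simp_all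
  finally show ?thesis using assms by (simp add: algebra_simps)
qed

lemma alpha_beta_M: "(\<alpha> * \<beta> * of_nat M) ^ k \<doteq> 1"
proof -
  have "\<alpha> * \<beta> * of_nat M \<doteq> 1"
    by (rule scong_linear[OF NM', of 1]) (simp_all add: algebra_simps)
  from scong_power[OF this, of k] show ?thesis by simp
qed

text \<open>Frobenius gives \<open>?B ^ p\<close> = \<open>?B'\<close>, and the square identity
  turns \<open>?B ^ (2 * n)\<close> into \<open>X\<close>, which contains \<open>A\<close>. So
  \<open>?B'\<close> = \<open>?B * X\<close> modulo p; multiplying by \<open>?B'\<close> instead of
  dividing by \<open>?B\<close> makes both sides explicit.\<close>

lemma quartic_power_mod4_1:
  assumes "\<chi> = - 1" "2 * E = v * (A - A')" "E \<in> S" "n = 2 * m"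
  shows "\<i> * of_nat a * E * \<beta> ^ m \<doteq> \<alpha> ^ m"
proof -
  have p4: "p mod 4 = 1" using assms(4) p by simp
  define X where "X = \<alpha> ^ n * of_nat M ^ m * A"
  have X [simp]: "X \<in> S" by (simp add: X_def)
  let ?B = "\<alpha> * v + \<i>" and ?B' = "- \<alpha> * v + \<i>"
  have "?B * ?B ^ (2 * n) = ?B ^ p" by (simp add: p)
  also have "\<dots> \<doteq> ?B'" using frobenius_linear[OF assms(1)] p4 by (simp add: i_power_mod4)
  finally have 1: "?B' \<doteq> ?B * ?B ^ (2 * n)" by (rule scong_sym)
  have "?B ^ (2 * n) \<doteq> (2 * \<i> * \<alpha> * v * (1 + v)) ^ n"
    unfolding power_mult by (intro scong_power square_identity) simp_all
  also have "\<dots> = X * (2 * \<i>) ^ n"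
    using even_power_v[of m] assms(4) by (simp add: X_def power_mult_distrib)
  also have "\<dots> \<doteq> X * 1" by (intro scong_lmult two_i_power p4 X)
  finally have "?B * ?B ^ (2 * n) \<doteq> ?B * X" by (intro scong_lmult) simp_all
  from scong_trans[OF 1 this] have 2: "?B' * ?B' \<doteq> ?B' * (?B * X)" by (intro scong_lmult) simp_all
  have 3: "2 * \<i> * \<alpha> * v * (v - 1) \<doteq> ?B' * (?B * X)"
    using scong_trans[OF scong_sym[OF square_identity'] 2[folded power2_eq_square]] .
  \<comment> \<open>The product is \<open>- 1 - \<alpha>^2 * v^2\<close>; replace 1 by
    \<open>\<alpha> * \<beta> * v^2\<close> and use
    \<open>\<alpha> + \<beta> = 2 * a\<close>.\<close>
  have "?B' * ?B \<doteq> 2 * \<alpha> * v * (- of_nat a * v)"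
    by (rule scong_linear[OF NM_v, of 1]) (simp_all add: algebra_simps)
  then have "X * (?B' * ?B) \<doteq> X * (2 * \<alpha> * v * (- of_nat a * v))" by (intro scong_lmult X)
  with 3 have "(2 * \<alpha> * v) * (\<i> * (v - 1)) \<doteq> (2 * \<alpha> * v) * (- of_nat a * v * X)"
    using scong_trans by (simp add: mult_ac)
  then have 4: "\<i> * (v - 1) \<doteq> - of_nat a * v * X"
    by (rule sunit_cancel) (intro sunit_mult unit_2 unit_alpha unit_v, simp_all)
  \<comment> \<open>Multiplying by -(1+v) turns v-1 into 1-M, that is, into a^2 v^2, from which a
    factor a v cancels.\<close>
  have "\<i> * ((1 - v) * (1 + v)) \<doteq> \<i> * (v * of_nat a)\<^sup>2" by (intro scong_lmult one_minus_M) simp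
  moreover have "(- (1 + v)) * (\<i> * (v - 1)) \<doteq> (- (1 + v)) * (- of_nat a * v * X)"
    using 4 by (intro scong_lmult) simp_all
  moreover have "(- (1 + v)) * (\<i> * (v - 1)) = \<i> * ((1 - v) * (1 + v))" by (simp add: algebra_simps)
  ultimately have "\<i> * (v * of_nat a)\<^sup>2 \<doteq> (- (1 + v)) * (- of_nat a * v * X)"
    using scong_trans scong_sym by metis
  then have "(of_nat a * v) * (\<i> * of_nat a * v) \<doteq> (of_nat a * v) * (X * (1 + v))"
    by (simp add: algebra_simps power2_eq_square)
  then have 5: "\<i> * of_nat a * v \<doteq> X * (1 + v)"
    by (rule sunit_cancel) (auto intro!: sunit_mult unit_a unit_v)
  have "\<i> * of_nat a * (E * (A * (1 + v))) \<doteq> \<i> * of_nat a * v"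
    by (intro scong_lmult half_diff_cong assms) simp
  from scong_trans[OF this 5]
  have "(A * (1 + v)) * (\<i> * of_nat a * E) \<doteq> (A * (1 + v)) * (\<alpha> ^ n * of_nat M ^ m)"
    by (simp add: X_def mult_ac)
  then have "\<i> * of_nat a * E \<doteq> \<alpha> ^ n * of_nat M ^ m"
    by (rule sunit_cancel) (use assms in \<open>auto intro!: sunit_mult sunit_power unit_1v\<close>)
  then have "\<beta> ^ m * (\<i> * of_nat a * E) \<doteq> \<beta> ^ m * (\<alpha> ^ n * of_nat M ^ m)"
    by (rule scong_lmult) simp
  also have "\<beta> ^ m * (\<alpha> ^ n * of_nat M ^ m) = \<alpha> ^ m * (\<alpha> * \<beta> * of_nat M) ^ m"
    by (simp add: assms(4) power_mult_distrib power_add mult_2)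
  also have "\<dots> \<doteq> \<alpha> ^ m * 1" by (intro scong_lmult alpha_beta_M) simp
  finally show ?thesis by (simp add: mult_ac)
qed

text \<open>Here n+1 is even, so the power p+1 = 2(n+1) is the natural one. With Frobenius the
  product \<open>?B * ?B ^ p\<close> collapses to \<open>- 2 * a * \<i> * v\<close>, because
  \<open>1 - \<alpha> * \<beta> * v^2\<close> vanishes modulo p.\<close>

lemma quartic_power_mod4_3:
  assumes "\<chi> = - 1" "2 * E = v * (A - A')" "E \<in> S" "n + 1 = 2 * m"
  shows "- \<i> * of_nat a * E * \<beta> ^ m \<doteq> \<alpha> ^ m"
proof -
  have p4: "p mod 4 = 3" using assms(4) p by presburger
  define Y where "Y = \<alpha> ^ (n + 1) * of_nat M ^ m"
  have Y [simp]: "Y \<in> S" by (simp add: Y_def)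
  let ?B = "\<alpha> * v + \<i>"
  have "?B * ?B ^ p \<doteq> ?B * (- \<beta> * v - \<i>)"
    using frobenius_linear[OF assms(1)] p4 by (intro scong_lmult) (simp_all add: i_power_mod4)
  also have "?B * (- \<beta> * v - \<i>) \<doteq> 2 * (- of_nat a * \<i> * v)"
    by (rule scong_linear[OF NM_v, of "-1"]) (simp_all add: algebra_simps)
  finally have 1: "?B * ?B ^ p \<doteq> 2 * (- of_nat a * \<i> * v)" .
  have "?B * ?B ^ p = (?B\<^sup>2) ^ (n + 1)"
    unfolding power_mult[symmetric] power_Suc[symmetric] by (simp add: p)
  also have "\<dots> \<doteq> (2 * \<i> * \<alpha> * v * (1 + v)) ^ (n + 1)"
    by (intro scong_power square_identity) simp_all
  also have "\<dots> = (Y * A * (1 + v)) * (2 * \<i>) ^ (n + 1)"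
    unfolding power_mult_distrib Y_def even_power_v[symmetric] assms(4)[symmetric] by simp
  also have "\<dots> \<doteq> (Y * A * (1 + v)) * 2" by (intro scong_lmult two_i_power p4) simp_all
  finally have "2 * (- of_nat a * \<i> * v) \<doteq> (Y * A * (1 + v)) * 2"
    using 1 scong_trans scong_sym by blast
  then have "2 * (- of_nat a * \<i> * v) \<doteq> 2 * (Y * A * (1 + v))" by (simp add: mult_ac)
  then have 5: "- of_nat a * \<i> * v \<doteq> Y * A * (1 + v)"
    by (rule sunit_cancel) (auto intro!: unit_2)
  have "- of_nat a * \<i> * (E * (A * (1 + v))) \<doteq> - of_nat a * \<i> * v"
    by (intro scong_lmult half_diff_cong assms) simp
  from scong_trans[OF this 5]
  have "(A * (1 + v)) * (- \<i> * of_nat a * E) \<doteq> (A * (1 + v)) * Y"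
    by (simp add: mult_ac)
  then have "- \<i> * of_nat a * E \<doteq> Y"
    by (rule sunit_cancel) (use assms in \<open>auto intro!: sunit_mult sunit_power unit_1v\<close>)
  then have "\<beta> ^ m * (- \<i> * of_nat a * E) \<doteq> \<beta> ^ m * Y"
    by (rule scong_lmult) simp
  also have "\<beta> ^ m * Y = \<alpha> ^ m * (\<alpha> * \<beta> * of_nat M) ^ m"
    unfolding Y_def assms(4) by (simp add: power_mult_distrib power_add mult_2)
  also have "\<dots> \<doteq> \<alpha> ^ m * 1" by (intro scong_lmult alpha_beta_M) simp
  finally show ?thesis by (simp add: mult_ac)
qed

end

section \<open>Descent to the Gaussian integers\<close>

definition Zi_adj :: "complex \<Rightarrow> complex set" where
  "Zi_adj v = {x + y * v | x y. x \<in> Zi \<and> y \<in> Zi}"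

lemma Zi_adjI: "x \<in> Zi \<Longrightarrow> y \<in> Zi \<Longrightarrow> x + y * v \<in> Zi_adj v"
  unfolding Zi_adj_def by blast

lemma complex_subring_Zi_adj:
  assumes "v * v \<in> Zi" shows "complex_subring (Zi_adj v)"
proof
  show "1 \<in> Zi_adj v" "\<i> \<in> Zi_adj v" using Zi_adjI[of 1 0 v] Zi_adjI[of \<i> 0 v] by simp_all
next
  fix s t assume "s \<in> Zi_adj v" "t \<in> Zi_adj v"
  then obtain x y x' y' where *: "x \<in> Zi" "y \<in> Zi" "x' \<in> Zi" "y' \<in> Zi" "s = x + y * v" "t = x' + y' * v"
    unfolding Zi_adj_def by blast
  have "s - t = (x - x') + (y - y') * v" "s * t = (x * x' + y * y' * (v * v)) + (x * y' + y * x') * v"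
    using * by (simp_all add: algebra_simps)
  then show "s - t \<in> Zi_adj v" "s * t \<in> Zi_adj v"
    using * assms by (simp_all only:) (intro Zi_adjI; simp)+
qed

text \<open>No irrationality of the square root is needed: move \<open>p * g\<close> to the left and square.\<close>
lemma prime_dvd_of_sqrt_multiple:
  fixes e g h :: int
  assumes "real_of_int e = real p * (of_int g + of_int h * sqrt (real M))" "prime p"
  shows "int p dvd e"
proof -
  have "real_of_int ((e - int p * g)\<^sup>2) = (real p * (of_int h * sqrt (real M)))\<^sup>2"
    using assms(1) by (simp add: algebra_simps)
  also have "\<dots> = real_of_int (int p * (int p * h\<^sup>2 * int M))"
    by (simp add: power_mult_distrib power2_eq_square)
  finally have "(e - int p * g)\<^sup>2 = int p * (int p * h\<^sup>2 * int M)" by (simp only: of_int_eq_iff)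
  then have "int p dvd (e - int p * g)\<^sup>2" by (metis dvd_triv_left)
  then have "int p dvd e - int p * g" using assms(2) by (metis prime_dvd_power prime_nat_int_transfer)
  then show ?thesis by (metis dvd_diff_right_iff dvd_triv_left dvd_diff_left_iff)
qed

text \<open>The square root is real, so real and imaginary parts separate, each being an integer of
  the form p(g + h sqrt M).\<close>

lemma scong_Zi_adj_imp_Zi:
  assumes "prime p" "x \<in> Zi" "y \<in> Zi"
    and "scong (Zi_adj (of_real (sqrt (real M)))) (of_nat p) x y"
  shows "scong Zi (of_nat p) x y"
proof -
  obtain z where "z \<in> Zi_adj (of_real (sqrt (real M)))" "x - y = of_nat p * z"
    using assms(4) unfolding scong_def by blast
  then obtain g h where gh: "g \<in> Zi" "h \<in> Zi" "x - y = of_nat p * (g + h * of_real (sqrt (real M)))"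
    by (auto simp: Zi_adj_def)
  have "x - y \<in> Zi" using assms by simp
  then obtain e1 e2 g1 g2 h1 h2 where *: "Re (x - y) = of_int e1" "Im (x - y) = of_int e2"
    "Re g = of_int g1" "Im g = of_int g2" "Re h = of_int h1" "Im h = of_int h2"
    using gh unfolding Zi_def by (auto elim!: Ints_cases)
  have "int p dvd e1" "int p dvd e2"
    using prime_dvd_of_sqrt_multiple[OF _ assms(1), of e1 g1 h1 M] prime_dvd_of_sqrt_multiple[OF _ assms(1), of e2 g2 h2 M]
      arg_cong[OF gh(3), of Re] arg_cong[OF gh(3), of Im] * by simp_all
  then obtain f1 f2 where "e1 = int p * f1" "e2 = int p * f2" by (auto elim!: dvdE)
  then have "x - y = of_nat p * Complex (of_int f1) (of_int f2)"
    using * by (simp add: complex_eq_iff)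
  moreover have "Complex (of_int f1) (of_int f2) \<in> Zi" by (simp add: Zi_def)
  ultimately show ?thesis unfolding scong_def by blast
qed

section \<open>The integer E and its residue modulo p\<close>

lemma odd_binomial_sum:
  fixes v :: "'a :: comm_ring_1"
  shows "v * ((1 + v) ^ n - (1 - v) ^ n) =
    2 * (\<Sum>j\<in>{1..(n + 1) div 2}. of_nat (n choose (2 * j - 1)) * (v * v) ^ j)"
proof -
  let ?f = "\<lambda>r. 2 * (of_nat (n choose r) * v ^ (r + 1))"
  have "v * ((1 + v) ^ n - (1 - v) ^ n) = (\<Sum>r\<le>n. of_nat (n choose r) * (v ^ (r + 1) - v * (- v) ^ r))"
    using binomial_ring[of v 1 n] binomial_ring[of "- v" 1 n]
    by (simp add: add.commute algebra_simps sum_distrib_left sum_subtractf)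
  \<comment> \<open>Even r cancel. For r = 2j-1 the extra factor \<open>v\<close> makes the exponent
    even, so only powers of v^2 remain.\<close>
  also have "\<dots> = (\<Sum>r\<le>n. if odd r then ?f r else 0)"
    by (intro sum.cong) (auto simp: algebra_simps)
  also have "\<dots> = sum ?f {r \<in> {..n}. odd r}"
    by (rule sum.inter_filter[symmetric]) simp
  also have "{r \<in> {..n}. odd r} = (\<lambda>j. 2 * j - 1) ` {1..(n + 1) div 2}"
  proof (intro equalityI subsetI)
    fix r assume "r \<in> {r \<in> {..n}. odd r}"
    then have "(r + 1) div 2 \<in> {1..(n + 1) div 2}" "r = 2 * ((r + 1) div 2) - 1"
      by (auto elim!: oddE)
    then show "r \<in> (\<lambda>j. 2 * j - 1) ` {1..(n + 1) div 2}" by blast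
  qed auto
  also have "sum ?f \<dots> = (\<Sum>j\<in>{1..(n + 1) div 2}. (?f \<circ> (\<lambda>j. 2 * j - 1)) j)"
    by (rule sum.reindex) (auto simp: inj_on_def)
  also have "\<dots> = (\<Sum>j\<in>{1..(n + 1) div 2}. 2 * (of_nat (n choose (2 * j - 1)) * (v * v) ^ j))"
  proof (intro sum.cong refl)
    fix j assume "j \<in> {1..(n + 1) div 2}"
    then have "v ^ (2 * j - 1 + 1) = (v * v) ^ j" by (simp add: power_mult power2_eq_square)
    then show "(?f \<circ> (\<lambda>j. 2 * j - 1)) j = 2 * (of_nat (n choose (2 * j - 1)) * (v * v) ^ j)"
      by (simp only: o_def)
  qed
  also have "\<dots> = 2 * (\<Sum>j\<in>{1..(n + 1) div 2}. of_nat (n choose (2 * j - 1)) * (v * v) ^ j)"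
    by (simp only: sum_distrib_left)
  finally show ?thesis .
qed

text \<open>The data known before the quadratic character of \<open>M\<close>: \<open>v\<close> is
  fixed as the real square root, and \<open>sqrt_setting\<close> is entered only once
  \<open>M ^ n\<close> has been found to be 1 or -1 modulo p.\<close>

locale int_setting =
  fixes p a b M n :: nat
  assumes prime: "prime p" and p: "p = 2 * n + 1"
    and ab: "[a * b = 1] (mod p)"
    and NM: "[(a\<^sup>2 + 1) * M = 1] (mod p)"
begin

definition "E = (\<Sum>j\<in>{1..(n + 1) div 2}. (n choose (2 * j - 1)) * M ^ j)"
definition "v = complex_of_real (sqrt (real M))"

lemma v2: "v * v = of_nat M"
  by (simp add: v_def flip: of_real_mult)

lemma two_E: "2 * of_nat E = v * ((1 + v) ^ n - (1 - v) ^ n)"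
  by (simp add: odd_binomial_sum v2 E_def)

lemma sqrt_setting:
  assumes "[int M ^ n = \<chi>] (mod int p)"
  shows "sqrt_setting (Zi_adj v) p a b M n v (of_int \<chi>)"
proof -
  interpret complex_subring "Zi_adj v" by (rule complex_subring_Zi_adj) (simp add: v2)
  show ?thesis
  proof
    show "v \<in> Zi_adj v" using Zi_adjI[of 0 1 v] by simp
    show "scong (Zi_adj v) (of_nat p) (of_nat M ^ n) (of_int \<chi>)"
      using scong_of_int[OF assms] by simp
  qed (use prime p ab NM v2 in simp_all)
qed

lemma E_cong_0:
  assumes "[int M ^ n = 1] (mod int p)"
  shows "int p dvd int E"
proof -
  interpret sqrt_setting "Zi_adj v" p a b M n v "of_int 1" by (rule sqrt_setting[OF assms])
  have "scong (Zi_adj v) (of_nat p) (v * ((1 + v) ^ n - (1 - v) ^ n)) (v * ((1 - v) ^ n - (1 - v) ^ n))"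
    by (intro scong_lmult scong_diff A_eq_A') simp_all
  then have "scong (Zi_adj v) (of_nat p) (2 * of_nat E) (2 * 0)" by (simp flip: two_E)
  then have "scong (Zi_adj v) (of_nat p) (of_nat E) 0"
    by (rule sunit_cancel[OF _ unit_2]) simp_all
  then have "scong Zi (of_nat p) (of_nat E) 0"
    unfolding v_def by (intro scong_Zi_adj_imp_Zi[OF prime]) simp_all
  then show ?thesis using scong_Zi_of_nat[of p "int E"] by simp
qed

lemma Zi_units:
  shows "Zi.sunit (of_nat p) (of_nat a + \<i>)" "Zi.sunit (of_nat p) (of_nat a - \<i>)"
  using Gauss_inverse[OF NM] by (auto intro!: Zi.sunitI)

lemma Zi_norm: "scong Zi (of_nat p) ((of_nat a + \<i>) * (of_nat a - \<i>) * of_nat M) 1"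
  using Gauss_inverse(1)[OF NM] by (simp add: mult_ac)

text \<open>Squaring the quartic congruence forces \<open>M ^ n\<close> = -1 modulo p, so
  \<open>quartic_power_mod4_1\<close> becomes available. It and the symbol both express (a+i)^m as a
  multiple of (a-i)^m modulo \<open>q\<close>; comparing the factors gives the claim.\<close>

lemma E_split:
  assumes p4: "p mod 4 = 1" and \<gamma>: "\<gamma> \<in> Zi" "scong Zi (of_nat p) \<gamma> (of_nat a + \<i>)"
    and e: "quartic_symp \<gamma> p = \<i> * of_int e" "e \<in> {1, -1}"
  shows "[int a * int E = e] (mod int p)"
proof -
  let ?a = "of_nat a + \<i> :: complex" and ?b = "of_nat a - \<i> :: complex"
  define m where "m = (p - 1) div 4"
  have nm: "n = 2 * m" "m = (p - 1) div 4" using p p4 unfolding m_def by presburger+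
  have "\<i> * of_int e \<in> {\<i>, - \<i>}" using e(2) by auto
  then obtain q where q: "q \<in> Zi" "gnorm q = int p"
    and ab: "scong Zi q (?a ^ m) (\<i> * of_int e * ?b ^ m)"
    using quartic_symp_split[OF prime p4 NM \<gamma> e(1)] unfolding nm(2) by blast
  have mq: "scong Zi q x y" if "scong Zi (of_nat p) x y" for x y
    using Zi.scong_modulus_mult[of q "cnj q" x y] mult_cnj_gnorm[OF q(1)] that q by simp
  have ee: "(\<i> * of_int e)\<^sup>2 = -1" using e(2) by (auto simp: power_mult_distrib)
  have "scong Zi q (?a ^ n) (- (?b ^ n))"
    using Zi.scong_power[OF ab, of 2] e ee by (simp add: nm(1) mult.commute power_mult_distrib flip: power_mult)
  \<comment> \<open>The factor is chosen so that the left side becomes 1; on the right, (a-i)^(2n) =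
    (a-i)^(p-1) is 1 modulo p and only \<open>- (M ^ n)\<close> is left.\<close>
  then have "scong Zi q (?b ^ n * of_nat M ^ n * ?a ^ n) (?b ^ n * of_nat M ^ n * (- (?b ^ n)))"
    by (rule Zi.scong_lmult) simp
  moreover have "?b ^ n * of_nat M ^ n * ?a ^ n = (?a * ?b * of_nat M) ^ n"
    by (simp add: power_mult_distrib mult_ac)
  moreover have "?b ^ n * of_nat M ^ n * (- (?b ^ n)) = - (of_nat M ^ n) * ?b ^ (2 * n)"
  proof -
    have "?b ^ (2 * n) = ?b ^ n * ?b ^ n" by (simp only: mult_2 power_add)
    then show ?thesis by (simp add: mult_ac)
  qed
  moreover have "scong Zi q ((?a * ?b * of_nat M) ^ n) 1"
    using Zi.scong_power[OF mq[OF Zi_norm], of n] by simp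
  moreover have "scong Zi q (- (of_nat M ^ n) * ?b ^ (2 * n)) (- (of_nat M ^ n) * 1)"
  proof (intro Zi.scong_lmult mq)
    have "odd p" using p by simp
    then have "scong Zi (of_nat p) (?b * ?b ^ (2 * n)) (?b * 1)"
      using Zi.scong_frobenius_Gauss(2)[OF prime, of a] i_power_mod4(1)[OF p4]
      by (simp add: p power_minus_odd)
    then show "scong Zi (of_nat p) (?b ^ (2 * n)) 1"
      by (rule Zi.sunit_cancel[OF _ Zi_units(2)]) simp_all
  qed simp
  ultimately have "scong Zi q 1 (- (of_nat M ^ n))"
    using Zi.scong_trans Zi.scong_sym by (metis mult.right_neutral)
  then have "scong Zi q (of_int (1 + int M ^ n)) 0" by (simp add: scong_def)
  then have "int p dvd 1 + int M ^ n" by (rule scong_Zi_gnorm[OF _ q prime])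
  then have "[int M ^ n = -1] (mod int p)" by (simp add: cong_iff_dvd_diff add.commute)
  then interpret R: sqrt_setting "Zi_adj v" p a b M n v "of_int (-1)" by (rule sqrt_setting)
  have "scong (Zi_adj v) (of_nat p) (\<i> * of_nat a * of_nat E * ?b ^ m) (?a ^ m)"
    by (rule R.quartic_power_mod4_1) (use two_E nm in simp_all)
  then have "scong Zi (of_nat p) (\<i> * of_nat a * of_nat E * ?b ^ m) (?a ^ m)"
    unfolding v_def by (intro scong_Zi_adj_imp_Zi[OF prime]) simp_all
  from Zi.scong_trans[OF mq[OF this] ab]
  have "scong Zi q ((\<i> * ?b ^ m) * (of_nat a * of_nat E)) ((\<i> * ?b ^ m) * of_int e)"
    by (simp add: mult_ac)
  moreover have "Zi.sunit q (\<i> * ?b ^ m)"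
  proof (intro Zi.sunit_mult Zi.sunit_power)
    show "Zi.sunit q \<i>" by (rule Zi.sunitI[of _ "- \<i>"]) simp_all
    show "Zi.sunit q ?b" using Zi_units(2) mq unfolding Zi.sunit_def by blast
  qed
  ultimately have "scong Zi q (of_nat a * of_nat E) (of_int e)" by (rule Zi.sunit_cancel) simp_all
  then have "scong Zi q (of_int (int a * int E - e)) 0" by (simp add: scong_def)
  from scong_Zi_gnorm[OF this q prime] show ?thesis by (simp add: cong_iff_dvd_diff)
qed

text \<open>As in the split case, but modulo p itself. The symbol expresses (a-i)^m through (a+i)^m;
  substituting it into \<open>quartic_power_mod4_3\<close> gives a E e = 1, and e^2 = 1
  finishes.\<close>

lemma E_inert:
  assumes p4: "p mod 4 = 3" and \<gamma>: "\<gamma> \<in> Zi" "scong Zi (of_nat p) \<gamma> (of_nat a + \<i>)"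
    and e: "quartic_symp \<gamma> p = \<i> * of_int e" "e \<in> {1, -1}"
  shows "[int a * int E = e] (mod int p)"
proof -
  let ?a = "of_nat a + \<i> :: complex" and ?b = "of_nat a - \<i> :: complex"
  define m where "m = (p + 1) div 4"
  have nm: "n + 1 = 2 * m" "m = (p + 1) div 4" using p p4 unfolding m_def by presburger+
  have ab: "scong Zi (of_nat p) (\<i> * of_int e * ?a ^ m) (?b ^ m)"
    using quartic_symp_inert[OF prime p4 NM \<gamma>] unfolding nm(2) e(1) .
  have ee: "(\<i> * of_int e)\<^sup>2 = -1" using e(2) by (auto simp: power_mult_distrib)
  have "scong Zi (of_nat p) (- (?a ^ (n + 1))) (?b ^ (n + 1))"
    using Zi.scong_power[OF ab, of 2] ee unfolding nm(1)
    by (simp add: mult.commute power_mult_distrib flip: power_mult)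
  \<comment> \<open>The right side becomes 1. On the left, (a+i)^(2n+2) = (a+i)^(p+1) is (a+i)(a-i)
    by Frobenius, which absorbs one factor \<open>M\<close> and leaves
    \<open>- (M ^ n)\<close>.\<close>
  then have "scong Zi (of_nat p) (of_nat M ^ (n + 1) * ?a ^ (n + 1) * (- (?a ^ (n + 1))))
      (of_nat M ^ (n + 1) * ?a ^ (n + 1) * (?b ^ (n + 1)))"
    by (rule Zi.scong_lmult) simp
  moreover have "of_nat M ^ (n + 1) * ?a ^ (n + 1) * (?b ^ (n + 1)) = (?a * ?b * of_nat M) ^ (n + 1)"
    by (simp only: power_mult_distrib mult_ac)
  moreover have "of_nat M ^ (n + 1) * ?a ^ (n + 1) * (- (?a ^ (n + 1))) = - (of_nat M ^ (n + 1) * ?a) * ?a ^ p"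
  proof -
    have "(n + 1) + (n + 1) = Suc p" using p by simp
    then have "?a ^ (n + 1) * ?a ^ (n + 1) = ?a * ?a ^ p" by (simp only: flip: power_add power_Suc)
    then show ?thesis by (simp only: mult_minus_left mult_minus_right mult.assoc)
  qed
  moreover have "scong Zi (of_nat p) ((?a * ?b * of_nat M) ^ (n + 1)) 1"
    using Zi.scong_power[OF Zi_norm, of "n + 1"] by simp
  moreover have "scong Zi (of_nat p) (- (of_nat M ^ (n + 1) * ?a) * ?a ^ p) (- (of_nat M ^ (n + 1) * ?a) * ?b)"
    using Zi.scong_frobenius_Gauss(1)[OF prime, of a] i_power_mod4(2)[OF p4]
    by (intro Zi.scong_lmult) simp_all
  moreover have "- (of_nat M ^ (n + 1) * ?a) * ?b = - (of_nat M ^ n) * (?a * ?b * of_nat M)" by (simp add: mult_ac)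
  moreover have "scong Zi (of_nat p) (- (of_nat M ^ n) * (?a * ?b * of_nat M)) (- (of_nat M ^ n) * 1)"
    by (intro Zi.scong_lmult Zi_norm) simp
  ultimately have "scong Zi (of_nat p) 1 (- (of_nat M ^ n))"
    using Zi.scong_trans Zi.scong_sym by (metis mult.right_neutral)
  then have "scong Zi (of_nat p) (of_int (1 + int M ^ n)) 0" by (simp add: scong_def)
  then have "int p dvd 1 + int M ^ n" by (rule scong_Zi_of_nat)
  then have "[int M ^ n = -1] (mod int p)" by (simp add: cong_iff_dvd_diff add.commute)
  then interpret R: sqrt_setting "Zi_adj v" p a b M n v "of_int (-1)" by (rule sqrt_setting)
  have "scong (Zi_adj v) (of_nat p) (- \<i> * of_nat a * of_nat E * ?b ^ m) (?a ^ m)"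
    by (rule R.quartic_power_mod4_3) (use two_E nm in simp_all)
  then have 1: "scong Zi (of_nat p) (- \<i> * of_nat a * of_nat E * ?b ^ m) (?a ^ m)"
    unfolding v_def by (intro scong_Zi_adj_imp_Zi[OF prime]) simp_all
  have "scong Zi (of_nat p) (- \<i> * of_nat a * of_nat E * (\<i> * of_int e * ?a ^ m)) (- \<i> * of_nat a * of_nat E * ?b ^ m)"
    by (intro Zi.scong_lmult ab) simp
  from Zi.scong_trans[OF this 1]
  have "scong Zi (of_nat p) (?a ^ m * (of_nat a * of_nat E * of_int e)) (?a ^ m * 1)"
    by (simp add: mult_ac)
  then have "scong Zi (of_nat p) (of_nat a * of_nat E * of_int e) 1"
    by (rule Zi.sunit_cancel) (simp_all add: Zi.sunit_power Zi_units)
  then have "scong Zi (of_nat p) (of_int (int a * int E * e - 1)) 0" by (simp add: scong_def)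
  from scong_Zi_of_nat[OF this] have "[int a * int E * e = 1] (mod int p)" by (simp add: cong_iff_dvd_diff)
  from cong_mult[OF this cong_refl[of e]] show ?thesis using e(2) by auto
qed

end

section \<open>p-integral rationals\<close>

text \<open>The reduced denominator divides every other one, so fractions need not be in lowest
  terms.\<close>

lemma Zp_iff:
  assumes "prime p"
  shows "x \<in> Zp p \<longleftrightarrow> (\<exists>k l. \<not> int p dvd l \<and> x = of_int k / of_int l)"
proof
  assume "x \<in> Zp p"
  moreover have "x = of_int (fst (quotient_of x)) / of_int (snd (quotient_of x))"
    by (rule quotient_of_div) simp
  ultimately show "\<exists>k l. \<not> int p dvd l \<and> x = of_int k / of_int l" unfolding Zp_def by blast
next
  assume "\<exists>k l. \<not> int p dvd l \<and> x = of_int k / of_int l"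
  then obtain k l where kl: "\<not> int p dvd l" "x = of_int k / of_int l" by blast
  obtain f g where fg: "quotient_of x = (f, g)" by force
  then have g: "x = of_int f / of_int g" "g > 0" "coprime f g"
    using quotient_of_div quotient_of_denom_pos quotient_of_coprime by blast+
  have l: "l \<noteq> 0" using kl by auto
  have "(of_int (f * l) :: rat) = of_int (k * g)" using g(1,2) kl(2) l by (simp add: field_simps)
  then have "f * l = k * g" by (simp only: of_int_eq_iff)
  then have "g dvd f * l" by simp
  then have "g dvd l" using g(3) by (metis coprime_commute coprime_dvd_mult_right_iff)
  then show "x \<in> Zp p" using kl(1) fg by (auto simp: Zp_def intro: dvd_trans)
qed

lemma subring_Zp:
  assumes "prime p" shows "subring (Zp p)"
proof
  have "\<not> int p dvd 1" using assms by auto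
  then show "1 \<in> Zp p" by (simp add: Zp_def)
next
  fix x y assume "x \<in> Zp p" "y \<in> Zp p"
  then obtain k l k' l' where *: "\<not> int p dvd l" "x = of_int k / of_int l"
    "\<not> int p dvd l'" "y = of_int k' / of_int l'" unfolding Zp_iff[OF assms] by blast
  have "prime (int p)" using assms by simp
  then have "\<not> int p dvd l * l'" using * by (simp add: prime_dvd_mult_iff)
  moreover have "l \<noteq> 0" "l' \<noteq> 0" using * by auto
  then have "x - y = of_int (k * l' - k' * l) / of_int (l * l')" "x * y = of_int (k * k') / of_int (l * l')"
    unfolding *(2,4) by (simp_all add: field_simps)
  ultimately show "x - y \<in> Zp p" "x * y \<in> Zp p" unfolding Zp_iff[OF assms] by blast+
qed

lemma rat_cong_eq_scong: "rat_cong p = scong (Zp p) (of_nat p)"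
  by (intro ext) (simp add: rat_cong_def scong_def)

lemma rat_cong_of_int_iff:
  assumes "prime p"
  shows "rat_cong p (of_int x) (of_int y) \<longleftrightarrow> [x = y] (mod int p)"
proof
  interpret subring "Zp p" by (rule subring_Zp[OF assms])
  show "[x = y] (mod int p) \<Longrightarrow> rat_cong p (of_int x) (of_int y)"
    unfolding rat_cong_eq_scong by (rule scong_of_int)
  assume "rat_cong p (of_int x) (of_int y)"
  then obtain k l where kl: "\<not> int p dvd l" "(of_int x - of_int y :: rat) = of_nat p * (of_int k / of_int l)"
    unfolding rat_cong_def Bex_def Zp_iff[OF assms] by blast
  have "l \<noteq> 0" using kl by auto
  then have "(of_int ((x - y) * l) :: rat) = of_int (int p * k)" using kl(2) by (simp add: field_simps)
  then have "(x - y) * l = int p * k" by (simp only: of_int_eq_iff)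
  then have "int p dvd (x - y) * l" by simp
  moreover have "prime (int p)" using assms by simp
  ultimately show "[x = y] (mod int p)"
    using kl(1) by (simp add: prime_dvd_mult_iff cong_iff_dvd_diff)
qed

lemma inverse_mod_prime:
  assumes "prime p" "\<not> int p dvd l"
  obtains l' :: nat where "[l * int l' = 1] (mod int p)"
proof -
  have "coprime l (int p)"
    using assms by (metis coprime_commute prime_imp_coprime prime_nat_int_transfer)
  then obtain x where x: "[l * x = 1] (mod int p)" using cong_solve_coprime_int by blast
  have "[l * (x mod int p) = l * x] (mod int p)" by (intro cong_scalar_left) simp
  moreover have "int (nat (x mod int p)) = x mod int p" using prime_gt_0_nat[OF assms(1)] by simp
  ultimately have "[l * int (nat (x mod int p)) = l * x] (mod int p)" by (simp only:)
  from that[OF cong_trans[OF this x]] show ?thesis .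
qed

text \<open>Gives the \<open>SOME\<close> in \<open>rep\<close> its meaning: for x = k/l a witness
  is k times an inverse of l modulo p.\<close>

lemma rat_cong_rep:
  assumes "prime p" "x \<in> Zp p"
  shows "rat_cong p x (of_int (rep p x))"
proof -
  obtain k l where kl: "\<not> int p dvd l" "x = of_int k / of_int l" using assms Zp_iff by blast
  obtain m where "[l * int m = 1] (mod int p)" using inverse_mod_prime[OF assms(1) kl(1)] .
  moreover define l' where "l' = int m"
  ultimately obtain t where "l * l' - 1 = int p * t" by (auto simp: cong_iff_dvd_diff)
  then have t: "(of_int l * of_int l' - 1 :: rat) = of_nat p * of_int t"
    by (metis of_int_1 of_int_diff of_int_mult of_int_of_nat_eq)
  have "l \<noteq> 0" using kl by auto
  then have "x - of_int (k * l') = - of_int k * (of_int l * of_int l' - 1) / of_int l"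
    by (simp add: kl field_simps)
  also have "\<dots> = of_nat p * (of_int (- k * t) / of_int l)" unfolding t by simp
  finally have "x - of_int (k * l') = of_nat p * (of_int (- k * t) / of_int l)" .
  moreover have "of_int (- k * t) / of_int l \<in> Zp p" using kl(1) Zp_iff[OF assms(1)] by blast
  ultimately have "rat_cong p x (of_int (k * l'))" unfolding rat_cong_def by blast
  then show ?thesis unfolding rep_def by (rule someI)
qed

lemma Zp_inverse:
  assumes "prime p" "x \<in> Zp p" "\<not> rat_cong p x 0"
  shows "inverse x \<in> Zp p"
proof -
  obtain k l where kl: "\<not> int p dvd l" "x = of_int k / of_int l" using assms Zp_iff by blast
  have "\<not> int p dvd k"
  proof
    assume "int p dvd k"
    then obtain t where "k = int p * t" by blast
    then have "x - 0 = of_nat p * (of_int t / of_int l)" using kl by simp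
    moreover have "of_int t / of_int l \<in> Zp p" using kl(1) Zp_iff[OF assms(1)] by blast
    ultimately show False using assms(3) unfolding rat_cong_def by blast
  qed
  moreover have "inverse x = of_int l / of_int k" using kl by simp
  ultimately show ?thesis using Zp_iff[OF assms(1)] by blast
qed

lemma rat_cong_inverse:
  assumes "prime p" "x \<in> Zp p" "rat_cong p (x * y) 1" "y \<in> Zp p"
  shows "inverse x \<in> Zp p" and "rat_cong p (inverse x) y"
proof -
  interpret subring "Zp p" by (rule subring_Zp[OF assms(1)])
  have n0: "\<not> rat_cong p x 0"
  proof
    assume "rat_cong p x 0"
    then have "rat_cong p (y * x) (y * 0)"
      unfolding rat_cong_eq_scong by (rule scong_lmult) fact
    then have "scong (Zp p) (of_nat p) 0 (x * y)"
      unfolding rat_cong_eq_scong mult.commute[of y] by (simp add: scong_sym)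
    then have "rat_cong p (of_int 0) (of_int 1)"
      using assms(3) scong_trans unfolding rat_cong_eq_scong by auto
    then have "[0 = 1] (mod int p)" using rat_cong_of_int_iff[OF assms(1)] by blast
    then show False using assms(1) by (auto simp: cong_iff_dvd_diff)
  qed
  then have "x \<noteq> 0" unfolding rat_cong_eq_scong by auto
  show i: "inverse x \<in> Zp p" by (rule Zp_inverse[OF assms(1,2) n0])
  have "rat_cong p (inverse x * (x * y)) (inverse x * 1)"
    using assms(3) unfolding rat_cong_eq_scong by (rule scong_lmult) fact
  then show "rat_cong p (inverse x) y"
    using \<open>x \<noteq> 0\<close> scong_sym unfolding rat_cong_eq_scong by (simp flip: mult.assoc)
qed

text \<open>\<open>Y\<close> is the residue of \<open>1 / (16 * (c\<^sup>2 + 1))\<close>.\<close>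
locale sum_setting = int_setting p a b "16 * Y" n for p a b Y n :: nat
begin

text \<open>\<open>T\<close> models the second sum of the theorem and \<open>U\<close> the first, in
  natural numbers and without the factors in front.\<close>

definition "T = (\<Sum>j\<in>{1..(p + 1) div 4}. ((4 * j - 2) choose (2 * j - 1)) * Y ^ j)"
definition "U = (\<Sum>k\<in>{(p + 1) div 2..(3 * p) div 4}. ((4 * k) choose (2 * k)) * Y ^ k)"

text \<open>With r = 2j-1 the coefficient is binomial(2r, r). The factors -4 and (-4)^(2j-1) combine
  to 16^j, which turns Y^j into M^j for \<open>M = 16 * Y\<close>.\<close>

lemma T_cong_E: "[- 4 * int T = int E] (mod int p)"
proof -
  have r: "(p + 1) div 4 = (n + 1) div 2" using p by presburger
  have "- 4 * int T = (\<Sum>j\<in>{1..(n + 1) div 2}. - 4 * (int ((4 * j - 2) choose (2 * j - 1)) * int Y ^ j))"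
    unfolding T_def r by (simp add: sum_distrib_left)
  also have "[\<dots> = (\<Sum>j\<in>{1..(n + 1) div 2}. int ((n choose (2 * j - 1)) * (16 * Y) ^ j))] (mod int p)"
  proof (rule cong_sum)
    fix j assume j: "j \<in> {1..(n + 1) div 2}"
    then have "2 * j - 1 \<le> n" by auto
    from central_binomial_cong_half[OF prime p this]
    have "[int ((4 * j - 2) choose (2 * j - 1)) = (- 4) ^ (2 * j - 1) * int (n choose (2 * j - 1))] (mod int p)"
      by (simp add: diff_mult_distrib2)
    from cong_mult[OF cong_refl[of "- 4"] cong_mult[OF this cong_refl[of "int Y ^ j"]]]
    have "[- 4 * (int ((4 * j - 2) choose (2 * j - 1)) * int Y ^ j)
      = - 4 * ((- 4) ^ (2 * j - 1) * int (n choose (2 * j - 1)) * int Y ^ j)] (mod int p)" .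
    moreover have "(- 4 :: int) * (- 4) ^ (2 * j - 1) = 16 ^ j"
    proof -
      have "(- 4 :: int) * (- 4) ^ (2 * j - 1) = (- 4) ^ Suc (2 * j - 1)" by simp
      also have "Suc (2 * j - 1) = 2 * j" using j by auto
      also have "(- 4 :: int) ^ (2 * j) = 16 ^ j" by (simp add: power_mult)
      finally show ?thesis .
    qed
    then have "- 4 * ((- 4) ^ (2 * j - 1) * int (n choose (2 * j - 1)) * int Y ^ j)
      = int ((n choose (2 * j - 1)) * (16 * Y) ^ j)" by (simp add: power_mult_distrib flip: mult.assoc)
    ultimately show "[- 4 * (int ((4 * j - 2) choose (2 * j - 1)) * int Y ^ j)
      = int ((n choose (2 * j - 1)) * (16 * Y) ^ j)] (mod int p)" by simp
  qed
  finally show ?thesis by (simp add: E_def)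
qed

text \<open>Substituting k = j+n gives 2k = p + (2j-1), the shift by p of the central binomial
  congruence, and matches the two summation ranges exactly.\<close>

lemma U_cong_T: "[U = 2 * Y ^ n * T] (mod p)"
proof -
  have r: "(p + 1) div 4 = (n + 1) div 2" "(p + 1) div 2 = 1 + n" "(3 * p) div 4 = (n + 1) div 2 + n"
    using p by presburger+
  have 1: "U = (\<Sum>j\<in>{1..(n + 1) div 2}. ((4 * (j + n)) choose (2 * (j + n))) * Y ^ (j + n))"
    unfolding U_def r by (rule sum.shift_bounds_cl_nat_ivl)
  have "[(\<Sum>j\<in>{1..(n + 1) div 2}. ((4 * (j + n)) choose (2 * (j + n))) * Y ^ (j + n))
      = (\<Sum>j\<in>{1..(n + 1) div 2}. 2 * Y ^ n * (((4 * j - 2) choose (2 * j - 1)) * Y ^ j))] (mod p)"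
  proof (rule cong_sum)
    fix j assume j: "j \<in> {1..(n + 1) div 2}"
    then have le: "2 * (2 * j - 1) < p" using p by auto
    have e: "p + (2 * j - 1) = 2 * (j + n)" "2 * (2 * (j + n)) = 4 * (j + n)" "2 * (2 * j - 1) = 4 * j - 2"
      using p j by auto
    have "[(4 * (j + n)) choose (2 * (j + n)) = 2 * ((4 * j - 2) choose (2 * j - 1))] (mod p)"
      using central_binomial_cong_shift[OF prime le] unfolding e .
    from cong_mult[OF this cong_refl[of "Y ^ (j + n)"]]
    show "[((4 * (j + n)) choose (2 * (j + n))) * Y ^ (j + n)
      = 2 * Y ^ n * (((4 * j - 2) choose (2 * j - 1)) * Y ^ j)] (mod p)"
      by (simp add: power_add mult_ac)
  qed
  moreover have "(\<Sum>j\<in>{1..(n + 1) div 2}. 2 * Y ^ n * (((4 * j - 2) choose (2 * j - 1)) * Y ^ j)) = 2 * Y ^ n * T"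
    by (simp only: T_def r(1) sum_distrib_left)
  ultimately show ?thesis by (simp only: 1)
qed

lemma fermat_n:
  assumes "[int x * y = 1] (mod int p)" shows "[int x ^ (2 * n) = 1] (mod int p)"
proof -
  have "\<not> int p dvd int x"
  proof
    assume "int p dvd int x"
    then have "[int x * y = 0] (mod int p)" by (simp add: cong_0_iff)
    then have "[0 = 1] (mod int p)" using assms cong_trans cong_sym by blast
    then show False using prime by (auto simp: cong_iff_dvd_diff)
  qed
  then have "[x ^ (p - 1) = 1] (mod p)" using fermat_theorem[OF prime] by simp
  then show ?thesis using p by (simp flip: cong_int_iff)
qed

lemma NM_int: "[(int a ^ 2 + 1) * (16 * int Y) = 1] (mod int p)"
  using NM by (simp add: algebra_simps flip: cong_int_iff)

lemma M_power_n: "[int (16 * Y) ^ n = 1] (mod int p) \<or> [int (16 * Y) ^ n = -1] (mod int p)"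
proof -
  have "[int (16 * Y) * (int a ^ 2 + 1) = 1] (mod int p)" using NM_int by (simp add: mult_ac)
  from fermat_n[OF this] have "int p dvd (int (16 * Y) ^ n - 1) * (int (16 * Y) ^ n - (-1))"
    by (simp add: cong_iff_dvd_diff power_mult power2_eq_square power_mult_distrib algebra_simps)
  moreover have "prime (int p)" using prime by simp
  ultimately show ?thesis by (simp only: prime_dvd_mult_iff cong_iff_dvd_diff)
qed

text \<open>16^n = 4^(2n) = 4^(p-1) is 1 modulo p.\<close>

lemma Y_power_n: "[int Y ^ n = int (16 * Y) ^ n] (mod int p)"
proof -
  have "[int 4 * (4 * int Y * (int a ^ 2 + 1)) = 1] (mod int p)" using NM_int by (simp add: mult_ac)
  from fermat_n[OF this] have "[16 ^ n = 1] (mod int p)" by (simp add: power_mult)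
  from cong_mult[OF this cong_refl[of "int Y ^ n"]] show ?thesis
    by (simp add: power_mult_distrib cong_sym)
qed

text \<open>The factor \<open>2 * Y ^ n\<close> is -2 when \<open>M ^ n\<close> = -1, which is the
  claim. When \<open>M ^ n\<close> = 1 it has the wrong sign, but then \<open>T\<close> vanishes
  modulo p and both sides are 0.\<close>

lemma U_cong: "[2 * int a * int U = - 4 * int a * int T] (mod int p)"
proof -
  have "[int U = 2 * int Y ^ n * int T] (mod int p)" using U_cong_T by (simp flip: cong_int_iff)
  then have 1: "[2 * int a * int U = 2 * int a * (2 * int Y ^ n * int T)] (mod int p)"
    by (rule cong_scalar_left)
  from M_power_n show ?thesis
  proof
    assume *: "[int (16 * Y) ^ n = -1] (mod int p)"
    have "[(4 * int a * int T) * int Y ^ n = (4 * int a * int T) * -1] (mod int p)"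
      by (intro cong_scalar_left cong_trans[OF Y_power_n *])
    then show ?thesis using cong_trans[OF 1] by (simp add: mult_ac)
  next
    assume "[int (16 * Y) ^ n = 1] (mod int p)"
    then have "int p dvd int E" by (rule E_cong_0)
    then have "[- 4 * int T = 0] (mod int p)" using T_cong_E by (meson cong_0_iff cong_trans)
    then have d: "int p dvd 4 * int T" by (simp add: cong_0_iff)
    have "2 * int a * (2 * int Y ^ n * int T) - (- 4 * int a * int T) = (int a * int Y ^ n + int a) * (4 * int T)"
      by (simp add: algebra_simps)
    then have "[2 * int a * (2 * int Y ^ n * int T) = - 4 * int a * int T] (mod int p)"
      using d unfolding cong_iff_dvd_diff by simp
    then show ?thesis using cong_trans[OF 1] by blast
  qed
qed

lemma T_cong_Legendre:
  assumes "[N = int a ^ 2 + 1] (mod int p)" "Legendre N (int p) = 1"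
  shows "[- 4 * int a * int T = 0] (mod int p)"
proof -
  have "p > 2" using prime prime_ge_2_nat[of p] p by (cases "p = 2") auto
  then have "[1 = N ^ ((p - 1) div 2)] (mod int p)" using euler_criterion[OF prime, of N] assms(2) by simp
  then have "[N ^ n = 1] (mod int p)" using p by (simp add: cong_sym)
  moreover have "[N * int (16 * Y) = 1] (mod int p)"
    using cong_trans[OF cong_mult[OF assms(1) cong_refl] NM_int] by simp
  then have "[N ^ n * int (16 * Y) ^ n = 1] (mod int p)"
    using cong_pow[of "N * int (16 * Y)" 1 "int p" n] by (simp add: power_mult_distrib)
  ultimately have "[int (16 * Y) ^ n = 1] (mod int p)"
    using cong_mult[OF _ cong_refl, of "N ^ n" 1 "int p" "int (16 * Y) ^ n"] cong_trans cong_sym by (metis mult_1)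
  then have "int p dvd int E" by (rule E_cong_0)
  then have "[- 4 * int T = 0] (mod int p)" using T_cong_E by (meson cong_0_iff cong_trans)
  from cong_scalar_left[OF this, of "int a"] show ?thesis by (simp add: mult_ac)
qed

lemma T_cong_quartic:
  assumes "\<gamma> \<in> Zi" "scong Zi (of_nat p) \<gamma> (of_nat a + \<i>)"
    and "quartic_symp \<gamma> p = \<i> * of_int e" "e \<in> {1, -1}"
  shows "[- 4 * int a * int T = e] (mod int p)"
proof -
  have "p mod 4 = 1 \<or> p mod 4 = 3" using p by presburger
  then have "[int a * int E = e] (mod int p)"
    using E_split[OF _ assms] E_inert[OF _ assms] by blast
  from cong_trans[OF cong_scalar_left[OF T_cong_E] this] show ?thesis by (simp add: mult_ac)
qed

end

theorem theorem3p1: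
  fixes p :: nat and c :: rat
  assumes "prime p" and "odd p" and "c \<in> Zp p"
    and "\<not> rat_cong p (c * (c^2 + 1)) 0"
  shows "rat_cong p
           (2 * c * (\<Sum>k\<in>{(p + 1) div 2 .. (3 * p) div 4}.
              of_nat ((4 * k) choose (2 * k)) / (16 * (c^2 + 1)) ^ k))
           (- 4 * c * (\<Sum>k\<in>{1 .. (p + 1) div 4}.
              of_nat ((4 * k - 2) choose (2 * k - 1)) / (16 * (c^2 + 1)) ^ k))
     \<and> (Legendre (rep p (c^2 + 1)) (int p) = 1 \<longrightarrow>
          rat_cong p (- 4 * c * (\<Sum>k\<in>{1 .. (p + 1) div 4}.
              of_nat ((4 * k - 2) choose (2 * k - 1)) / (16 * (c^2 + 1)) ^ k)) 0)
     \<and> (c \<in> Q 1 p \<longrightarrow>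
          rat_cong p (- 4 * c * (\<Sum>k\<in>{1 .. (p + 1) div 4}.
              of_nat ((4 * k - 2) choose (2 * k - 1)) / (16 * (c^2 + 1)) ^ k)) 1)
     \<and> (c \<in> Q 3 p \<longrightarrow>
          rat_cong p (- 4 * c * (\<Sum>k\<in>{1 .. (p + 1) div 4}.
              of_nat ((4 * k - 2) choose (2 * k - 1)) / (16 * (c^2 + 1)) ^ k)) (-1))"
proof -
  interpret Zp: subring "Zp p" by (rule subring_Zp[OF assms(1)])
  note iff = rat_cong_of_int_iff[OF assms(1), unfolded rat_cong_eq_scong]
  note rep = rat_cong_rep[OF assms(1), unfolded rat_cong_eq_scong]
  have p0: "p > 0" using assms(1) prime_gt_0_nat by blast
  have pint: "prime (int p)" using assms(1) by simp
  obtain n where n: "p = 2 * n + 1" using assms(2) by (auto elim: oddE)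
  \<comment> \<open>Natural numbers \<open>a\<close>, \<open>b\<close>, \<open>Y\<close> stand for
    the residues of c, 1/c and 1/(16(c^2+1)), which moves the whole statement from p-integral
    rationals to integers.\<close>
  define a where "a = nat (rep p c mod int p)"
  have ra: "[rep p c = int a] (mod int p)" using p0 by (simp add: a_def)
  have ca: "scong (Zp p) (of_nat p) c (of_nat a)"
    using Zp.scong_trans[OF rep[OF assms(3)] Zp.scong_of_int[OF ra]] by simp
  have ca2: "scong (Zp p) (of_nat p) (c\<^sup>2 + 1) ((of_nat a)\<^sup>2 + 1)"
    using assms(3) by (intro Zp.scong_add Zp.scong_power ca) simp_all
  have "\<not> scong (Zp p) (of_nat p) (of_int (int a * (int a ^ 2 + 1))) (of_int 0)"
  proof
    assume *: "scong (Zp p) (of_nat p) (of_int (int a * (int a ^ 2 + 1))) (of_int 0)"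
    have "scong (Zp p) (of_nat p) (c * (c\<^sup>2 + 1)) (of_nat a * ((of_nat a)\<^sup>2 + 1))"
      using assms(3) by (intro Zp.scong_mult ca ca2) simp_all
    also have "scong (Zp p) (of_nat p) \<dots> 0" using * by simp
    finally show False using assms(4) by (simp add: rat_cong_eq_scong)
  qed
  then have "\<not> int p dvd int a * (int a ^ 2 + 1)" unfolding iff by (simp add: cong_0_iff)
  then have nd: "\<not> int p dvd int a" "\<not> int p dvd int a ^ 2 + 1" by auto
  have "\<not> int p dvd 16"
  proof
    assume "int p dvd 16"
    then have "p dvd 2 ^ 4" by (simp flip: int_dvd_int_iff)
    then have "p dvd 2" using assms(1) prime_dvd_power by blast
    then show False using assms(1,2) by (metis primes_dvd_imp_eq two_is_prime_nat even_numeral dvd_refl)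
  qed
  then have nd16: "\<not> int p dvd (int a ^ 2 + 1) * 16" using nd(2) pint prime_dvd_multD by blast
  obtain b where b: "[int a * int b = 1] (mod int p)" using inverse_mod_prime[OF assms(1) nd(1)] .
  obtain Y where Y: "[((int a ^ 2 + 1) * 16) * int Y = 1] (mod int p)"
    using inverse_mod_prime[OF assms(1) nd16] .
  interpret sum_setting p a b Y n
  proof
    show "[a * b = 1] (mod p)" using b by (simp flip: cong_int_iff)
    have "[int ((a\<^sup>2 + 1) * (16 * Y)) = int 1] (mod int p)" using Y by (simp add: algebra_simps)
    then show "[(a\<^sup>2 + 1) * (16 * Y) = 1] (mod p)" by (simp only: cong_int_iff)
  qed (use assms n in simp_all)
  let ?x = "16 * (c\<^sup>2 + 1)"
  have "rat_cong p (?x * of_nat Y) 1"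
  proof -
    have "scong (Zp p) (of_nat p) (of_nat Y * 16 * (c\<^sup>2 + 1)) (of_nat Y * 16 * ((of_nat a)\<^sup>2 + 1))"
      by (intro Zp.scong_lmult ca2) simp
    also have "scong (Zp p) (of_nat p) \<dots> 1"
      using Zp.scong_of_int[OF Y] by (simp add: mult_ac)
    finally show ?thesis unfolding rat_cong_eq_scong by (simp add: mult_ac)
  qed
  note inv = rat_cong_inverse[OF assms(1) _ this]
  have iZ: "inverse ?x \<in> Zp p" and xY: "rat_cong p (inverse ?x) (of_nat Y)"
    using assms(3) by (intro inv; simp)+
  \<comment> \<open>Since 1/(16(c^2+1)) is p-integral and congruent to \<open>Y\<close>, the sums
    can be reduced term by term.\<close>
  have sum: "scong (Zp p) (of_nat p) (\<Sum>k\<in>I. of_nat (f k) / ?x ^ k) (of_nat (\<Sum>k\<in>I. f k * Y ^ k))" for f I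
  proof -
    have "(\<Sum>k\<in>I. of_nat (f k) / ?x ^ k) = (\<Sum>k\<in>I. of_nat (f k) * inverse ?x ^ k)"
      by (simp only: divide_inverse power_inverse)
    also have "scong (Zp p) (of_nat p) \<dots> (\<Sum>k\<in>I. of_nat (f k) * of_nat Y ^ k)"
      using iZ xY unfolding rat_cong_eq_scong by (intro Zp.scong_sum Zp.scong_lmult Zp.scong_power) simp_all
    finally show ?thesis by simp
  qed
  have prod: "scong (Zp p) (of_nat p) (of_int z * c * s) (of_int (z * int a * int t))"
    if "scong (Zp p) (of_nat p) s (of_nat t)" "s \<in> Zp p" for z s t
  proof -
    have "scong (Zp p) (of_nat p) (c * s) (of_nat a * of_nat t)"
      using that by (intro Zp.scong_mult ca) simp_all
    from Zp.scong_lmult[OF this, of "of_int z"] show ?thesis by (simp add: mult.assoc)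
  qed
  have sumZ: "(\<Sum>k\<in>I. of_nat (f k) / ?x ^ k) \<in> Zp p" for f I
    using iZ by (intro Zp.sum_closed) (simp add: divide_inverse flip: power_inverse)
  let ?U = "2 * c * (\<Sum>k\<in>{(p + 1) div 2..(3 * p) div 4}. of_nat ((4 * k) choose (2 * k)) / ?x ^ k)"
  let ?T = "- 4 * c * (\<Sum>k\<in>{1..(p + 1) div 4}. of_nat ((4 * k - 2) choose (2 * k - 1)) / ?x ^ k)"
  have U: "scong (Zp p) (of_nat p) ?U (of_int (2 * int a * int U))"
    using prod[OF sum sumZ, of 2] unfolding U_def by simp
  have T: "scong (Zp p) (of_nat p) ?T (of_int (- 4 * int a * int T))"
    using prod[OF sum sumZ, of "-4"] unfolding T_def by simp
  have 1: "rat_cong p ?U ?T"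
    unfolding rat_cong_eq_scong
    using U T Zp.scong_of_int[OF U_cong] Zp.scong_trans Zp.scong_sym by blast
  have T_int: "rat_cong p ?T (of_int e)" if "[- 4 * int a * int T = e] (mod int p)" for e
    unfolding rat_cong_eq_scong by (rule Zp.scong_trans[OF T Zp.scong_of_int[OF that]])
  have 2: "rat_cong p ?T 0" if "Legendre (rep p (c\<^sup>2 + 1)) (int p) = 1"
  proof -
    have "scong (Zp p) (of_nat p) (of_int (rep p (c\<^sup>2 + 1))) (of_int (int a ^ 2 + 1))"
      using Zp.scong_trans[OF Zp.scong_sym[OF rep] ca2] assms(3) by simp
    then have "[rep p (c\<^sup>2 + 1) = int a ^ 2 + 1] (mod int p)" unfolding iff .
    from T_int[OF T_cong_Legendre[OF this that]] show ?thesis by simp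
  qed
  \<comment> \<open>\<open>rep p 1\<close> is a \<open>SOME\<close> choice of which only the residue
    is known; this is why the lemmas on the symbol allow any \<open>\<gamma>\<close> congruent to
    a+i.\<close>
  have "scong (Zp p) (of_nat p) (of_int (rep p 1)) (of_int 1)"
    using Zp.scong_sym[OF rep[of 1]] by simp
  then have r1: "[rep p 1 = 1] (mod int p)" unfolding iff .
  let ?g = "of_int (rep p c) + of_int (rep p 1) * \<i> :: complex"
  have g: "?g \<in> Zi" by simp
  have "scong Zi (of_nat p) ?g (of_int (int a) + of_int 1 * \<i>)"
    by (intro Zi.scong_add Zi.scong_mult Zi.scong_of_int ra r1) simp_all
  then have ga: "scong Zi (of_nat p) ?g (of_nat a + \<i>)" by simp
  have Q: "rat_cong p ?T (of_int e)" if "quartic_symp_rat c 1 p = \<i> * of_int e" "e \<in> {1, -1}" for e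
    using T_int[OF T_cong_quartic[OF g ga]] that unfolding quartic_symp_rat_def by blast
  have "\<i> ^ 3 = \<i> * of_int (-1)" by (simp add: numeral_3_eq_3)
  then have 3: "c \<in> Q 1 p \<Longrightarrow> rat_cong p ?T 1" "c \<in> Q 3 p \<Longrightarrow> rat_cong p ?T (-1)"
    using Q[of 1] Q[of "-1"] unfolding Q_def by simp_all
  from 1 2 3 show ?thesis by blast
qed

end
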